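(* Fix an integer $k \ge 3$. Let $X = X_{n,k,p}$ denote the number of $k$-subsets $\{x_1,\dots,x_k\} \subseteq [n]_p$ that form an arithmetic progression of length $k$, and let $\mu = \mathbb{E} X$. Then for every $\varepsilon > 0$ there are constants $c, C > 0$ and $n_0$ (depending only on $\varepsilon$ and $k$) such that for all $n \ge n_0$ and all $p \in (0,1]$ satisfying $1 \le (1+\varepsilon)\mu \le X_{n,k,1}$ we have $$\exp\Bigl(-C\min\bigl\{\mu,\; \mu^{1/2}\log(1/p)\bigr\}\Bigr) \le \mathbb{P}(X \ge (1+\varepsilon)\mu) \le \exp\Bigl(-c\min\bigl\{\mu,\; \mu^{1/2}\log(1/p)\bigr\}\Bigr).$$
   Context: $[n] = \{1,\dots,n\}$, and $[n]_p$ is the binomial random subset of $[n]$ in which each integer is included independently with probability $p$. $X_{n,k,1}$ is the (deterministic) value for $p=1$, i.e. the total number of $k$-subsets of $[n]$ forming an arithmetic progression of length $k$. *)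

theory Defs
  imports "HOL-Probability.Probability"
begin

definition random_subset :: "nat \<Rightarrow> real \<Rightarrow> nat set pmf" where
  "random_subset n p =
     map_pmf (\<lambda>f. {i \<in> {1..n}. f i}) (Pi_pmf {1..n} False (\<lambda>_. bernoulli_pmf p))"

definition is_AP :: "nat \<Rightarrow> nat set \<Rightarrow> bool" where
  "is_AP k S \<longleftrightarrow> (\<exists>a d. d > 0 \<and> S = {a + i * d | i. i < k})"

text \<open>Progressions are counted as sets, so a progression and its reversal count once.\<close>

definition AP_count :: "nat \<Rightarrow> nat set \<Rightarrow> nat" where
  "AP_count k A = card {S. S \<subseteq> A \<and> card S = k \<and> is_AP k S}"

definition AP_mean :: "nat \<Rightarrow> nat \<Rightarrow> real \<Rightarrow> real" where
  "AP_mean n k p = measure_pmf.expectation (random_subset n p) (\<lambda>A. real (AP_count k A))"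

end

theory Submission
  imports Defs "HOL-Real_Asymp.Real_Asymp"
begin

text \<open>
  The progressions form a \<open>k\<close>-uniform hypergraph on \<open>n\<close> vertices with quadratically many edges and codegrees
  at most \<open>k\<^sup>2\<close>, and nothing else about them is used, except that an interval of length \<open>m\<close> contains
  quadratically many of them. Put \<open>L = ln (1 / p)\<close>.

  Upper bound (after Harel, Mousset and Samotij). Call a set \<open>U\<close> of at most \<open>k l\<close> vertices a seed if conditioning
  on \<open>U\<close> being contained in the random set raises the mean above \<open>(1 + \<epsilon> / 2) \<mu>\<close>. On the event that there is no seed, the
  \<open>l\<close>-th moment is at most \<open>((1 + \<epsilon> / 2) \<mu>) ^ l\<close>, so Markov's inequality gives an exponential bound in
  \<open>l\<close>, which is taken to be a small multiple of \<open>\<Phi>\<close>. For \<open>p\<close> bounded away from 0 there are no seeds.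
  For small \<open>p\<close> a seed induces of order \<open>\<mu>\<close> edges, hence contains a core: a set of \<open>m\<close> vertices, \<open>m\<close> at least of order
  \<open>sqrt \<mu>\<close>, with large minimum degree. A random subset of small density of a core determines, up to
  a factor polynomial in \<open>L\<close> per vertex, the rest of the core, because every other vertex completes many edges
  with it. So there are few cores, and the union bound yields \<open>exp (- c sqrt \<mu> L)\<close>.

  Lower bound. Planting an interval of length of order \<open>sqrt \<mu>\<close> gives \<open>exp (- C sqrt \<mu> L)\<close>. If
  \<open>sqrt \<mu> \<le> L\<close>, the second moment of the number of sequences of \<open>r = \<lceil>(1 + \<epsilon>) \<mu>\<rceil>\<close> disjoint edges
  whose union induces only linearly many edges gives \<open>exp (- C \<mu>)\<close>.
\<close>

section \<open>Binomial random subsets\<close>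

text \<open>The ground set is arbitrary because sampling occurs twice: in \<open>V\<close> itself at
  density \<open>p\<close>, and in a core at density \<open>q\<close> when its generator is
  chosen.\<close>

definition binomial_subset :: "'a set \<Rightarrow> real \<Rightarrow> 'a set pmf" where
  "binomial_subset V p = map_pmf (\<lambda>f. {i \<in> V. f i}) (Pi_pmf V False (\<lambda>_. bernoulli_pmf p))"

lemma set_binomial_subset: "set_pmf (binomial_subset V p) \<subseteq> Pow V"
  by (auto simp: binomial_subset_def)

lemma prob_superset:
  assumes "finite V" "T \<subseteq> V" "0 \<le> p" "p \<le> 1"
  shows "measure_pmf.prob (binomial_subset V p) {A. T \<subseteq> A} = p ^ card T"
proof -
  let ?B = "\<lambda>i. if i \<in> T then {True} else UNIV"
  have "measure_pmf.prob (binomial_subset V p) {A. T \<subseteq> A} =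
      measure_pmf.prob (Pi_pmf V False (\<lambda>_. bernoulli_pmf p)) (Pi V ?B)"
    unfolding binomial_subset_def measure_map_pmf
    by (rule arg_cong[where f = "measure_pmf.prob _"]) (use assms(2) in \<open>auto simp: Pi_def split: if_splits\<close>)
  also have "\<dots> = (\<Prod>i\<in>V. measure_pmf.prob (bernoulli_pmf p) (?B i))"
    by (rule measure_Pi_pmf_Pi) fact
  also have "\<dots> = (\<Prod>i\<in>V. if i \<in> T then p else 1)"
    using assms by (intro prod.cong) (auto simp: measure_pmf_single)
  also have "\<dots> = p ^ card T"
    using assms by (simp add: prod.If_cases Int_absorb1)
  finally show ?thesis .
qed

lemma integrable_binomial_subset [simp]:
  fixes f :: "'a set \<Rightarrow> real"
  assumes "finite V"
  shows "integrable (measure_pmf (binomial_subset V p)) f"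
  by (rule integrable_measure_pmf_finite, rule finite_subset[OF set_binomial_subset]) (use assms in simp)

lemma expectation_of_bool:
  "measure_pmf.expectation M (\<lambda>A. of_bool (P A)) = measure_pmf.prob M {A. P A}"
proof -
  have "(\<lambda>A. of_bool (P A) :: real) = indicator {A. P A}" by (auto simp: indicator_def)
  then show ?thesis by simp
qed

lemma expectation_sum_of_bool:
  assumes "finite V"
  shows "measure_pmf.expectation (binomial_subset V p) (\<lambda>A. \<Sum>i\<in>I. of_bool (P i A))
    = (\<Sum>i\<in>I. measure_pmf.prob (binomial_subset V p) {A. P i A})"
  using assms by (subst Bochner_Integration.integral_sum) (simp_all only: expectation_of_bool integrable_binomial_subset)

lemma expectation_card:
  fixes q :: real
  assumes "finite U" "0 \<le> q" "q \<le> 1"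
  shows "measure_pmf.expectation (binomial_subset U q) (\<lambda>A. real (card (A \<inter> U))) = q * card U"
proof -
  have "measure_pmf.expectation (binomial_subset U q) (\<lambda>A. real (card (A \<inter> U)))
      = measure_pmf.expectation (binomial_subset U q) (\<lambda>A. \<Sum>v\<in>U. of_bool ({v} \<subseteq> A))"
    using assms(1) by (simp add: of_bool_def sum.If_cases Int_def conj_commute)
  also have "\<dots> = (\<Sum>v\<in>U. measure_pmf.prob (binomial_subset U q) {A. {v} \<subseteq> A})"
    using assms(1) by (rule expectation_sum_of_bool)
  also have "\<dots> = (\<Sum>v\<in>U. q)"
    using prob_superset[OF assms(1) _ assms(2,3), of "{_}"] by (intro sum.cong) auto
  finally show ?thesis by simp
qed

text \<open>Cauchy-Schwarz for \<open>Z\<close> and the indicator of \<open>Z \<noteq> 0\<close>. It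
  turns a second moment bound into a lower bound on the probability that some packing is
  present.\<close>

lemma second_moment_method:
  fixes Z :: "'b \<Rightarrow> real" and M :: "'b pmf"
  assumes "finite (set_pmf M)" "0 < measure_pmf.expectation M Z"
    and "measure_pmf.expectation M (\<lambda>A. (Z A)\<^sup>2) \<le> B"
  shows "(measure_pmf.expectation M Z)\<^sup>2 / B \<le> measure_pmf.prob M {A. Z A \<noteq> 0}"
proof -
  let ?E = "measure_pmf.expectation M"
  define a where "a = ?E Z"
  have int: "integrable (measure_pmf M) f" for f :: "'b \<Rightarrow> real"
    by (rule integrable_measure_pmf_finite) fact
  define \<pi> where "\<pi> = measure_pmf.prob M {A. Z A \<noteq> 0}"
  have a: "0 < a" using assms(2) a_def by simp
  \<comment> \<open>The multiplier \<open>B / a\<close> makes the square vanish in the extremal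
    case, where \<open>Z\<close> is constant wherever it is nonzero and \<open>B\<close> is its
    exact second moment.\<close>
  have "0 \<le> ?E (\<lambda>A. (Z A - B / a * of_bool (Z A \<noteq> 0))\<^sup>2)" by simp
  also have "(\<lambda>A. (Z A - B / a * of_bool (Z A \<noteq> 0))\<^sup>2)
      = (\<lambda>A. (Z A)\<^sup>2 - 2 * (B / a) * Z A + (B / a)\<^sup>2 * of_bool (Z A \<noteq> 0))"
    by (auto simp: power2_eq_square algebra_simps)
  also have "?E \<dots> = ?E (\<lambda>A. (Z A)\<^sup>2) - 2 * (B / a) * a + (B / a)\<^sup>2 * \<pi>"
    unfolding a_def \<pi>_def using int
    by (simp only: Bochner_Integration.integral_add Bochner_Integration.integral_diff
        integral_mult_right_zero expectation_of_bool)
  also have "2 * (B / a) * a = 2 * B" using a by simp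
  finally have *: "B \<le> (B / a)\<^sup>2 * \<pi>" using assms(3) by linarith
  show ?thesis
  proof (cases "0 < B")
    case True
    then have "a\<^sup>2 * B \<le> B * (B * \<pi>)"
      using * a by (simp add: power_divide pos_le_divide_eq power2_eq_square mult_ac)
    then have "a\<^sup>2 \<le> B * \<pi>" using True by (metis mult.commute mult_le_cancel_left_pos)
    then show ?thesis using True by (simp add: a_def \<pi>_def pos_divide_le_eq mult.commute)
  next
    case False
    then have "a\<^sup>2 / B \<le> 0" by (simp add: divide_nonneg_nonpos)
    then show ?thesis unfolding a_def by (meson measure_nonneg order_trans)
  qed
qed

lemma card_ge_2_obtain:
  assumes "2 \<le> card T"
  obtains x y where "x \<in> T" "y \<in> T" "x \<noteq> y"
  using assms by (meson card_2_iff' obtain_subset_with_card_n subsetD)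

section \<open>Uniform hypergraphs with bounded codegrees\<close>

locale codegree_hypergraph =
  fixes V :: "'a set" and H :: "'a set set" and k D :: nat
  assumes finite_V: "finite V"
    and edge_subset: "S \<in> H \<Longrightarrow> S \<subseteq> V"
    and edge_card: "S \<in> H \<Longrightarrow> card S = k"
    and k_ge_3: "3 \<le> k"
    and codegree: "x \<noteq> y \<Longrightarrow> card {S \<in> H. x \<in> S \<and> y \<in> S} \<le> D"
begin

definition induced :: "'a set \<Rightarrow> nat" where
  "induced U = card {S \<in> H. S \<subseteq> U}"

text \<open>The expected number of induced edges given that the random set contains
  \<open>U\<close>: only the vertices of \<open>S - U\<close> remain to be chosen, each with
  probability \<open>p\<close>.\<close>

definition cond_mean :: "real \<Rightarrow> 'a set \<Rightarrow> real" where
  "cond_mean p U = (\<Sum>S\<in>H. p ^ card (S - U))"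

lemma finite_H: "finite H"
  by (rule finite_subset[of _ "Pow V"]) (use finite_V edge_subset in auto)

lemma finite_edge: "S \<in> H \<Longrightarrow> finite S"
  using finite_V edge_subset finite_subset by blast

text \<open>Every edge through \<open>x\<close> has a second vertex \<open>y\<close>, and each
  choice of \<open>y\<close> accounts for at most \<open>D\<close> edges.\<close>

lemma degree_le:
  assumes "x \<in> V"
  shows "card {S \<in> H. x \<in> S} \<le> D * card V"
proof -
  have "{S \<in> H. x \<in> S} \<subseteq> (\<Union>y\<in>V-{x}. {S \<in> H. x \<in> S \<and> y \<in> S})"
  proof
    fix S assume S: "S \<in> {S \<in> H. x \<in> S}"
    then have "card (S - {x}) > 0"
      using edge_card[of S] finite_edge[of S] k_ge_3 by (simp add: card_Diff_singleton)
    then obtain y where "y \<in> S - {x}" by (metis card_gt_0_iff ex_in_conv)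
    with S edge_subset show "S \<in> (\<Union>y\<in>V-{x}. {S \<in> H. x \<in> S \<and> y \<in> S})" by blast
  qed
  then have "card {S \<in> H. x \<in> S} \<le> card (\<Union>y\<in>V-{x}. {S \<in> H. x \<in> S \<and> y \<in> S})"
    by (rule card_mono[rotated]) (use finite_H finite_V in auto)
  also have "\<dots> \<le> (\<Sum>y\<in>V-{x}. card {S \<in> H. x \<in> S \<and> y \<in> S})"
    by (rule card_UN_le) (use finite_V in auto)
  also have "\<dots> \<le> (\<Sum>y\<in>V-{x}. D)"
    by (rule sum_mono, rule codegree) auto
  also have "\<dots> \<le> D * card V"
    using finite_V by (simp add: card_mono mult.commute)
  finally show ?thesis .
qed

lemma card_meeting_le:
  assumes "U \<subseteq> V"
  shows "card {S \<in> H. S \<inter> U \<noteq> {}} \<le> card U * D * card V"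
proof -
  have fU: "finite U" using assms finite_V finite_subset by blast
  have "{S \<in> H. S \<inter> U \<noteq> {}} = (\<Union>x\<in>U. {S \<in> H. x \<in> S})" by blast
  then have "card {S \<in> H. S \<inter> U \<noteq> {}} \<le> (\<Sum>x\<in>U. card {S \<in> H. x \<in> S})"
    using fU by (simp add: card_UN_le)
  also have "\<dots> \<le> (\<Sum>x\<in>U. D * card V)"
    by (rule sum_mono, rule degree_le) (use assms in auto)
  finally show ?thesis by simp
qed

lemma card_meeting_twice_le:
  assumes fU: "finite U"
  shows "card {S \<in> H. 2 \<le> card (S \<inter> U)} \<le> D * (card U)\<^sup>2"
proof -
  let ?P = "{(x, y) \<in> U \<times> U. x \<noteq> y}"
  have fP: "finite ?P" by (rule finite_subset[of _ "U \<times> U"]) (use fU in auto)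
  have "{S \<in> H. 2 \<le> card (S \<inter> U)} \<subseteq> (\<Union>(x, y)\<in>?P. {S \<in> H. x \<in> S \<and> y \<in> S})"
  proof
    fix S assume S: "S \<in> {S \<in> H. 2 \<le> card (S \<inter> U)}"
    then obtain x y where "x \<in> S \<inter> U" "y \<in> S \<inter> U" "x \<noteq> y" using card_ge_2_obtain[of "S \<inter> U"] by blast
    with S show "S \<in> (\<Union>(x, y)\<in>?P. {S \<in> H. x \<in> S \<and> y \<in> S})" by blast
  qed
  then have "card {S \<in> H. 2 \<le> card (S \<inter> U)} \<le> card (\<Union>(x, y)\<in>?P. {S \<in> H. x \<in> S \<and> y \<in> S})"
    by (rule card_mono[rotated]) (use finite_H fP in auto)
  also have "\<dots> \<le> (\<Sum>z\<in>?P. card (case z of (x, y) \<Rightarrow> {S \<in> H. x \<in> S \<and> y \<in> S}))"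
    by (rule card_UN_le) (use fP in auto)
  also have "\<dots> \<le> (\<Sum>z\<in>?P. D)"
    by (rule sum_mono) (use codegree in auto)
  also have "\<dots> = card ?P * D" by simp
  also have "card ?P \<le> card (U \<times> U)" by (rule card_mono) (use fU in auto)
  finally show ?thesis by (simp add: card_cartesian_product power2_eq_square mult.commute)
qed

lemma card_edges_containing_two_le:
  assumes "finite U" "v \<in> U"
  shows "card {S \<in> H. v \<in> S \<and> S \<inter> (U - {v}) \<noteq> {}} \<le> D * card U"
proof -
  have "{S \<in> H. v \<in> S \<and> S \<inter> (U - {v}) \<noteq> {}} = (\<Union>y\<in>U-{v}. {S \<in> H. v \<in> S \<and> y \<in> S})" by blast
  then have "card {S \<in> H. v \<in> S \<and> S \<inter> (U - {v}) \<noteq> {}} \<le> (\<Sum>y\<in>U-{v}. card {S \<in> H. v \<in> S \<and> y \<in> S})"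
    using assms(1) by (simp add: card_UN_le)
  also have "\<dots> \<le> (\<Sum>y\<in>U-{v}. D)"
    by (rule sum_mono, rule codegree) auto
  also have "\<dots> \<le> D * card U" using assms by (simp add: mult.commute)
  finally show ?thesis .
qed

lemma induced_le: "finite U \<Longrightarrow> induced U \<le> D * (card U)\<^sup>2"
proof -
  assume fU: "finite U"
  have "induced U \<le> card {S \<in> H. 2 \<le> card (S \<inter> U)}"
    unfolding induced_def
  proof (rule card_mono)
    show "{S \<in> H. S \<subseteq> U} \<subseteq> {S \<in> H. 2 \<le> card (S \<inter> U)}"
      using edge_card k_ge_3 by (auto simp: Int_absorb2)
  qed (use finite_H in auto)
  with card_meeting_twice_le[OF fU] show ?thesis by linarith
qed

lemma cond_mean_nonneg: "0 \<le> p \<Longrightarrow> 0 \<le> cond_mean p U"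
  unfolding cond_mean_def by (intro sum_nonneg) auto

text \<open>Charges 1 to every edge that meets \<open>U\<close>. This is crude, but enough for
  \<open>p\<close> bounded away from 0.\<close>

lemma cond_mean_le_trivial:
  fixes p :: real
  assumes "U \<subseteq> V" "0 \<le> p" "p \<le> 1"
  shows "cond_mean p U \<le> card H * p ^ k + card U * D * card V"
proof -
  have "cond_mean p U \<le> (\<Sum>S\<in>H. p ^ k + of_bool (S \<inter> U \<noteq> {}))"
    unfolding cond_mean_def
  proof (rule sum_mono)
    fix S assume S: "S \<in> H"
    show "p ^ card (S - U) \<le> p ^ k + of_bool (S \<inter> U \<noteq> {})"
    proof (cases "S \<inter> U = {}")
      case True
      then have "S - U = S" by blast
      with True edge_card[OF S] show ?thesis by simp
    next
      case False
      have "p ^ card (S - U) \<le> 1" using assms by (simp add: power_le_one)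
      also have "1 \<le> p ^ k + 1" using assms by simp
      finally show ?thesis using False by simp
    qed
  qed
  also have "\<dots> = card H * p ^ k + card {S \<in> H. S \<inter> U \<noteq> {}}"
    using finite_H by (simp add: sum.distrib of_bool_def sum.If_cases Int_def)
  finally show ?thesis using card_meeting_le[OF assms(1)]
    by (smt (verit) of_nat_le_iff of_nat_mult)
qed

text \<open>The four terms stand for edges with no vertex, exactly one, at least two but not all,
  and all of their vertices in \<open>U\<close>. For small \<open>p\<close> the middle two will be a
  small multiple of the mean, which forces a seed to induce many edges.\<close>

lemma cond_mean_le:
  fixes p :: real
  assumes U: "U \<subseteq> V" and p: "0 \<le> p" "p \<le> 1"
  shows "cond_mean p U \<le> card H * p ^ k + card U * D * card V * p ^ (k - 1)
    + D * (card U)\<^sup>2 * p + induced U"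
proof -
  have fU: "finite U" using U finite_V finite_subset by blast
  have "cond_mean p U \<le> (\<Sum>S\<in>H. p ^ k + of_bool (S \<inter> U \<noteq> {}) * p ^ (k - 1)
      + of_bool (2 \<le> card (S \<inter> U)) * p + of_bool (S \<subseteq> U))"
    unfolding cond_mean_def
  proof (rule sum_mono)
    fix S assume S: "S \<in> H"
    have fS: "finite S" using S finite_edge by blast
    have c: "card (S - U) = k - card (S \<inter> U)"
      using card_Diff_subset_Int[of S U] fS edge_card[OF S] by simp
    have pos: "0 \<le> p ^ i" for i using p by simp
    have "card (S \<inter> U) = 0 \<longleftrightarrow> S \<inter> U = {}" using fS by simp
    then consider "S \<inter> U = {}" | "card (S \<inter> U) = 1" | "2 \<le> card (S \<inter> U)" "\<not> S \<subseteq> U" | "S \<subseteq> U"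
      by linarith
    then show "p ^ card (S - U) \<le> p ^ k + of_bool (S \<inter> U \<noteq> {}) * p ^ (k - 1)
      + of_bool (2 \<le> card (S \<inter> U)) * p + of_bool (S \<subseteq> U)"
    proof cases
      case 1
      then have "p ^ card (S - U) = p ^ k" using c by simp
      then show ?thesis using p pos[of "k-1"] by simp
    next
      case 2
      then have "S \<inter> U \<noteq> {}" by auto
      with 2 show ?thesis using c pos[of k] p by simp
    next
      case 3
      then have "card (S - U) > 0" using fS by (simp add: card_gt_0_iff)
      then have "p ^ card (S - U) \<le> p ^ 1" using p by (intro power_decreasing) auto
      with 3 show ?thesis using pos[of k] pos[of "k-1"] by (simp add: add_increasing add_increasing2)
    next
      case 4
      then have "card (S - U) = 0" by (simp add: Diff_eq_empty_iff[THEN iffD2])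
      with 4 show ?thesis using pos[of k] pos[of "k-1"] p by simp
    qed
  qed
  also have "\<dots> = card H * p ^ k + card {S \<in> H. S \<inter> U \<noteq> {}} * p ^ (k - 1)
      + card {S \<in> H. 2 \<le> card (S \<inter> U)} * p + induced U"
    using finite_H
    by (simp add: sum.distrib of_bool_def sum.If_cases Int_def induced_def if_distrib[where f = "\<lambda>x. x * _"] cong: if_cong)
  also have "\<dots> \<le> card H * p ^ k + card U * D * card V * p ^ (k - 1)
    + D * (card U)\<^sup>2 * p + induced U"
  proof -
    have "card {S \<in> H. S \<inter> U \<noteq> {}} * p ^ (k - 1) \<le> card U * D * card V * p ^ (k - 1)"
      by (rule mult_right_mono) (use card_meeting_le[OF U] p in \<open>simp_all only: of_nat_le_iff zero_le_power flip: of_nat_mult\<close>)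
    moreover have "card {S \<in> H. 2 \<le> card (S \<inter> U)} * p \<le> D * (card U)\<^sup>2 * p"
      by (rule mult_right_mono) (use card_meeting_twice_le[OF fU] p in \<open>simp_all only: of_nat_le_iff flip: of_nat_mult of_nat_power\<close>)
    ultimately show ?thesis by simp
  qed
  finally show ?thesis .
qed

section \<open>Moments in the absence of seeds\<close>

text \<open>A violating \<open>U\<close> is a seed. Later \<open>\<theta>\<close> is
  \<open>(1 + \<epsilon> / 2)\<close> times the mean, and \<open>b = k * l\<close> is the number of
  vertices that \<open>l\<close> edges can cover.\<close>

definition seedless :: "real \<Rightarrow> real \<Rightarrow> nat \<Rightarrow> 'a set \<Rightarrow> bool" where
  "seedless p \<theta> b A \<longleftrightarrow> (\<forall>U\<subseteq>A. card U \<le> b \<longrightarrow> cond_mean p U \<le> \<theta>)"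

lemma induced_eq_sum: "real (induced A) = (\<Sum>S\<in>H. of_bool (S \<subseteq> A))"
  using finite_H by (simp add: induced_def of_bool_def sum.If_cases Int_def)

text \<open>Induction on \<open>j\<close>: one factor \<open>induced A\<close> is expanded as a sum
  over edges \<open>S\<close>, and \<open>U\<close> is replaced by \<open>U \<union> S\<close>. This
  is why the event \<open>U \<subseteq> A\<close> is carried along; the budget
  \<open>card U + k * j \<le> k * l\<close> keeps \<open>U\<close> small enough for
  \<open>seedless\<close> to control its conditional mean.\<close>

lemma seedless_moment_le:
  fixes p \<theta> :: real
  assumes p: "0 \<le> p" "p \<le> 1" and "0 \<le> \<theta>"
    and "U \<subseteq> V" "card U + k * j \<le> k * l"
  shows "measure_pmf.expectation (binomial_subset V p)
      (\<lambda>A. real (induced A) ^ j * of_bool (seedless p \<theta> (k * l) A) * of_bool (U \<subseteq> A)) \<le> \<theta> ^ j * p ^ card U"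
  using assms(4,5)
proof (induction j arbitrary: U)
  case 0
  have "measure_pmf.expectation (binomial_subset V p)
      (\<lambda>A. of_bool (seedless p \<theta> (k * l) A) * of_bool (U \<subseteq> A)) \<le>
      measure_pmf.expectation (binomial_subset V p) (\<lambda>A. of_bool (U \<subseteq> A) :: real)"
    by (rule integral_mono) (use finite_V in auto)
  also have "\<dots> = p ^ card U"
    using prob_superset[OF finite_V 0(1) p] by (simp add: expectation_of_bool)
  finally show ?case by simp
next
  case (Suc j)
  let ?E = "measure_pmf.expectation (binomial_subset V p)"
  let ?Z = "\<lambda>A. of_bool (seedless p \<theta> (k * l) A) :: real"
  have fU: "finite U" using Suc.prems finite_V finite_subset by blast
  show ?case
  proof (cases "cond_mean p U \<le> \<theta>")
    case False
    have "card U \<le> k * l" using Suc.prems(2) by simp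
    \<comment> \<open>A seed cannot lie in a seedless \<open>A\<close>, so the integrand is
      identically 0.\<close>
    with False have "\<not> (seedless p \<theta> (k * l) A \<and> U \<subseteq> A)" for A
      unfolding seedless_def by blast
    then have "(\<lambda>A. real (induced A) ^ Suc j * ?Z A * of_bool (U \<subseteq> A)) = (\<lambda>_. 0)"
      by auto
    then show ?thesis using assms(1,3) by simp
  next
    case True
    have "(\<lambda>A. real (induced A) ^ Suc j * ?Z A * of_bool (U \<subseteq> A))
        = (\<lambda>A. \<Sum>S\<in>H. real (induced A) ^ j * ?Z A * of_bool (U \<union> S \<subseteq> A))"
    proof
      fix A
      have "real (induced A) ^ Suc j * ?Z A * of_bool (U \<subseteq> A)
          = (\<Sum>S\<in>H. of_bool (S \<subseteq> A)) * (real (induced A) ^ j * ?Z A * of_bool (U \<subseteq> A))"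
        by (simp add: induced_eq_sum)
      also have "\<dots> = (\<Sum>S\<in>H. real (induced A) ^ j * ?Z A * of_bool (U \<union> S \<subseteq> A))"
        unfolding sum_distrib_right by (intro sum.cong) auto
      finally show "real (induced A) ^ Suc j * ?Z A * of_bool (U \<subseteq> A)
          = (\<Sum>S\<in>H. real (induced A) ^ j * ?Z A * of_bool (U \<union> S \<subseteq> A))" .
    qed
    then have "?E (\<lambda>A. real (induced A) ^ Suc j * ?Z A * of_bool (U \<subseteq> A))
        = (\<Sum>S\<in>H. ?E (\<lambda>A. real (induced A) ^ j * ?Z A * of_bool (U \<union> S \<subseteq> A)))"
      using finite_V by (simp add: Bochner_Integration.integral_sum)
    also have "\<dots> \<le> (\<Sum>S\<in>H. \<theta> ^ j * p ^ card (U \<union> S))"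
    proof (rule sum_mono)
      fix S assume S: "S \<in> H"
      have "card (U \<union> S) \<le> card U + k"
        using card_Un_le[of U S] edge_card[OF S] by simp
      then show "?E (\<lambda>A. real (induced A) ^ j * ?Z A * of_bool (U \<union> S \<subseteq> A)) \<le> \<theta> ^ j * p ^ card (U \<union> S)"
        using Suc.prems edge_subset[OF S] by (intro Suc.IH) auto
    qed
    \<comment> \<open>Splitting off \<open>p ^ card U\<close> leaves exactly
      \<open>cond_mean p U\<close>, which is at most \<open>\<theta>\<close> in this case.\<close>
    also have "\<dots> = (\<Sum>S\<in>H. \<theta> ^ j * p ^ card U * p ^ card (S - U))"
    proof (rule sum.cong)
      fix S assume S: "S \<in> H"
      have "card (U \<union> S) = card U + card (S - U)"
        using card_Un_disjoint[of U "S - U"] fU finite_edge[OF S] by simp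
      then show "\<theta> ^ j * p ^ card (U \<union> S) = \<theta> ^ j * p ^ card U * p ^ card (S - U)"
        by (simp add: power_add)
    qed simp
    also have "\<dots> = \<theta> ^ j * p ^ card U * cond_mean p U"
      by (simp add: cond_mean_def sum_distrib_left)
    also have "\<dots> \<le> \<theta> ^ j * p ^ card U * \<theta>"
      using True assms(1,3) by (intro mult_left_mono) auto
    finally show ?thesis by (simp add: mult_ac)
  qed
qed

text \<open>Markov's inequality for the \<open>l\<close>-th moment restricted to seedless sets,
  bounded by the previous lemma with \<open>j = l\<close> and \<open>U = {}\<close>. The presence of
  a seed is paid for separately.\<close>

lemma upper_tail_le_seed:
  fixes p \<theta> t :: real
  assumes p: "0 \<le> p" "p \<le> 1" and "0 \<le> \<theta>" "0 < t"
  shows "measure_pmf.prob (binomial_subset V p) {A. t \<le> real (induced A)}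
    \<le> (\<theta> / t) ^ l + measure_pmf.prob (binomial_subset V p) {A. \<not> seedless p \<theta> (k * l) A}"
proof -
  let ?R = "binomial_subset V p"
  let ?Q = "{A. t \<le> real (induced A) \<and> seedless p \<theta> (k * l) A}"
  have "t ^ l * measure_pmf.prob ?R ?Q = measure_pmf.expectation ?R
      (\<lambda>A. t ^ l * of_bool (t \<le> real (induced A) \<and> seedless p \<theta> (k * l) A))"
    by (simp only: integral_mult_right_zero expectation_of_bool)
  also have "\<dots> \<le> measure_pmf.expectation ?R
      (\<lambda>A. real (induced A) ^ l * of_bool (seedless p \<theta> (k * l) A) * of_bool ({} \<subseteq> A))"
    by (rule integral_mono) (use finite_V assms in \<open>auto intro: power_mono\<close>)
  also have "\<dots> \<le> \<theta> ^ l * p ^ card ({} :: 'a set)"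
    by (rule seedless_moment_le) (use assms in auto)
  finally have "measure_pmf.prob ?R ?Q \<le> (\<theta> / t) ^ l"
    using assms(4) by (simp add: power_divide pos_le_divide_eq mult.commute)
  moreover have "measure_pmf.prob ?R {A. t \<le> real (induced A)}
      \<le> measure_pmf.prob ?R (?Q \<union> {A. \<not> seedless p \<theta> (k * l) A})"
    by (rule measure_pmf.finite_measure_mono) auto
  moreover have "\<dots> \<le> measure_pmf.prob ?R ?Q + measure_pmf.prob ?R {A. \<not> seedless p \<theta> (k * l) A}"
    by (rule measure_Un_le) auto
  ultimately show ?thesis by linarith
qed

lemma expectation_induced:
  fixes p :: real
  assumes "0 \<le> p" "p \<le> 1"
  shows "measure_pmf.expectation (binomial_subset V p) (\<lambda>A. real (induced A)) = card H * p ^ k"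
proof -
  have "measure_pmf.expectation (binomial_subset V p) (\<lambda>A. real (induced A))
      = (\<Sum>S\<in>H. measure_pmf.prob (binomial_subset V p) {A. S \<subseteq> A})"
    using finite_V by (simp add: induced_eq_sum expectation_of_bool)
  also have "\<dots> = (\<Sum>S\<in>H. p ^ k)"
    using prob_superset[OF finite_V edge_subset assms] edge_card by (intro sum.cong) auto
  finally show ?thesis by simp
qed

section \<open>Cores\<close>

text \<open>\<open>v\<close> may lie outside \<open>W\<close>; the value is then the number of edges
  that \<open>v\<close> completes together with \<open>W\<close>, which is how
  \<open>candidates\<close> uses it.\<close>

definition degree_in :: "'a set \<Rightarrow> 'a \<Rightarrow> nat" where
  "degree_in W v = card {S \<in> H. v \<in> S \<and> S - {v} \<subseteq> W}"

lemma degree_in_mono: "W \<subseteq> W' \<Longrightarrow> degree_in W v \<le> degree_in W' v"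
  unfolding degree_in_def by (rule card_mono) (use finite_H in auto)

text \<open>The core maximises \<open>induced W - d * card W\<close> over all subsets of
  \<open>U\<close>: deleting a vertex of degree below \<open>d\<close> would increase this
  value.\<close>

lemma core_exists:
  fixes d :: real
  assumes "finite U"
  obtains U' where "U' \<subseteq> U" "real (induced U) - d * card U \<le> real (induced U') - d * card U'"
    "\<And>v. v \<in> U' \<Longrightarrow> d \<le> degree_in U' v"
proof -
  define \<phi> where "\<phi> W = real (induced W) - d * card W" for W
  have fin: "finite (\<phi> ` Pow U)" using assms by simp
  have "Max (\<phi> ` Pow U) \<in> \<phi> ` Pow U" using fin by (intro Max_in) auto
  then obtain U' where U': "U' \<subseteq> U" "\<phi> U' = Max (\<phi> ` Pow U)" by auto
  have max: "\<phi> W \<le> \<phi> U'" if "W \<subseteq> U" for W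
    unfolding U'(2) by (rule Max_ge) (use fin that in auto)
  have fU': "finite U'" using U'(1) assms finite_subset by blast
  show thesis
  proof (rule that)
    show "U' \<subseteq> U" by fact
    show "real (induced U) - d * card U \<le> real (induced U') - d * card U'"
      using max[of U] by (simp add: \<phi>_def)
    fix v assume v: "v \<in> U'"
    have eq: "{S \<in> H. S \<subseteq> U'} = {S \<in> H. S \<subseteq> U' - {v}} \<union> {S \<in> H. v \<in> S \<and> S - {v} \<subseteq> U'}"
      using v by auto
    have "induced U' = induced (U' - {v}) + degree_in U' v"
      unfolding induced_def degree_in_def
      by (subst eq, rule card_Un_disjoint) (use finite_H in auto)
    moreover have "card U' = card (U' - {v}) + 1" using card.remove[OF fU' v] by simp
    moreover have "\<phi> (U' - {v}) \<le> \<phi> U'" using max U'(1) by blast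
    ultimately show "d \<le> degree_in U' v" by (simp add: \<phi>_def algebra_simps)
  qed
qed

definition candidates :: "real \<Rightarrow> 'a set \<Rightarrow> 'a set" where
  "candidates \<tau> W = {v \<in> V - W. \<tau> \<le> degree_in W v}"

text \<open>Double counting: an edge counted at a candidate \<open>v\<close> has \<open>v\<close> as
  its only vertex outside \<open>W\<close>, so no edge is counted twice, and each one meets
  \<open>W\<close> in \<open>k - 1 \<ge> 2\<close> vertices.\<close>

lemma card_candidates_le:
  assumes fW: "finite W"
  shows "\<tau> * card (candidates \<tau> W) \<le> D * (card W)\<^sup>2"
proof -
  let ?F = "\<lambda>v. {S \<in> H. v \<in> S \<and> S - {v} \<subseteq> W}"
  let ?C = "candidates \<tau> W"
  have fC: "finite ?C" unfolding candidates_def using finite_V by auto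
  have "\<tau> * card ?C = (\<Sum>v\<in>?C. \<tau>)" by simp
  also have "\<dots> \<le> (\<Sum>v\<in>?C. real (degree_in W v))"
    by (rule sum_mono) (auto simp: candidates_def)
  also have "\<dots> = real (\<Sum>v\<in>?C. card (?F v))" by (simp add: degree_in_def)
  also have "(\<Sum>v\<in>?C. card (?F v)) = card (\<Union>v\<in>?C. ?F v)"
  proof (rule card_UN_disjoint[symmetric])
    show "\<forall>v\<in>?C. \<forall>w\<in>?C. v \<noteq> w \<longrightarrow> ?F v \<inter> ?F w = {}"
      by (auto simp: candidates_def)
  qed (use fC finite_H in auto)
  also have "\<dots> \<le> card {S \<in> H. 2 \<le> card (S \<inter> W)}"
  proof (rule card_mono)
    show "(\<Union>v\<in>?C. ?F v) \<subseteq> {S \<in> H. 2 \<le> card (S \<inter> W)}"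
    proof clarify
      fix v S assume vS: "v \<in> ?C" "S \<in> H" "v \<in> S" "S - {v} \<subseteq> W"
      then have "S \<inter> W = S - {v}" by (auto simp: candidates_def)
      then have "card (S \<inter> W) = k - 1"
        using vS edge_card finite_edge by (simp add: card_Diff_singleton)
      then show "2 \<le> card (S \<inter> W)" using k_ge_3 by simp
    qed
  qed (use finite_H in auto)
  also have "\<dots> \<le> D * (card W)\<^sup>2" by (rule card_meeting_twice_le) fact
  finally show ?thesis by simp
qed

text \<open>A variance bound. Two edges through \<open>v\<close> without another common vertex give
  independent events and cancel against the squared mean. By the codegree bound each edge has at
  most \<open>k * D\<close> partners that share a further vertex with it.\<close>

lemma degree_in_second_moment:
  fixes q :: real
  assumes q: "0 \<le> q" "q \<le> 1" and U: "U \<subseteq> V" and v: "v \<in> U"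
  defines "s \<equiv> real (degree_in U v)"
  defines "F \<equiv> {S \<in> H. v \<in> S \<and> S - {v} \<subseteq> U}"
  shows "measure_pmf.expectation (binomial_subset U q)
    (\<lambda>A. (real (card {S \<in> F. S - {v} \<subseteq> A}) - s * q ^ (k - 1))\<^sup>2) \<le> s * k * D"
proof -
  let ?R = "binomial_subset U q"
  let ?E = "measure_pmf.expectation ?R"
  have fU: "finite U" using U finite_V finite_subset by blast
  have fF: "finite F" unfolding F_def using finite_H by auto
  have s: "s = card F" unfolding s_def F_def degree_in_def ..
  let ?Y = "\<lambda>A. \<Sum>S\<in>F. of_bool (S - {v} \<subseteq> A) :: real"
  have Y: "real (card {S \<in> F. S - {v} \<subseteq> A}) = ?Y A" for A
    using fF by (simp add: of_bool_def sum.If_cases Int_def)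
  have EY: "?E ?Y = s * q ^ (k - 1)"
  proof -
    have "?E ?Y = (\<Sum>S\<in>F. measure_pmf.prob ?R {A. S - {v} \<subseteq> A})"
      using fU by (simp add: expectation_of_bool)
    also have "\<dots> = (\<Sum>S\<in>F. q ^ (k - 1))"
    proof (rule sum.cong)
      fix S assume S: "S \<in> F"
      then have "card (S - {v}) = k - 1"
        using edge_card finite_edge unfolding F_def by (simp add: card_Diff_singleton)
      then show "measure_pmf.prob ?R {A. S - {v} \<subseteq> A} = q ^ (k - 1)"
        using prob_superset[OF fU _ q, of "S - {v}"] S unfolding F_def by simp
    qed simp
    finally show ?thesis by (simp add: s)
  qed
  have EY2: "?E (\<lambda>A. (?Y A)\<^sup>2) \<le> s\<^sup>2 * (q ^ (k - 1))\<^sup>2 + s * k * D"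
  proof -
    have "(\<lambda>A. (?Y A)\<^sup>2) = (\<lambda>A. \<Sum>S\<in>F. \<Sum>T\<in>F. of_bool (S \<union> T - {v} \<subseteq> A))"
      by (rule ext, unfold power2_eq_square sum_product, intro sum.cong) auto
    then have "?E (\<lambda>A. (?Y A)\<^sup>2) = (\<Sum>S\<in>F. \<Sum>T\<in>F. measure_pmf.prob ?R {A. S \<union> T - {v} \<subseteq> A})"
      using fU by (simp add: expectation_of_bool)
    also have "\<dots> \<le> (\<Sum>S\<in>F. \<Sum>T\<in>F. (q ^ (k - 1))\<^sup>2 + of_bool (T \<inter> (S - {v}) \<noteq> {}))"
    proof (intro sum_mono)
      fix S T assume ST: "S \<in> F" "T \<in> F"
      have fin: "finite S" "finite T" using ST finite_edge unfolding F_def by auto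
      have c: "card (S - {v}) = k - 1" "card (T - {v}) = k - 1"
        using ST fin edge_card unfolding F_def by (auto simp: card_Diff_singleton)
      have pr: "measure_pmf.prob ?R {A. S \<union> T - {v} \<subseteq> A} = q ^ card (S \<union> T - {v})"
        by (rule prob_superset[OF fU _ q]) (use ST F_def in auto)
      show "measure_pmf.prob ?R {A. S \<union> T - {v} \<subseteq> A}
          \<le> (q ^ (k - 1))\<^sup>2 + of_bool (T \<inter> (S - {v}) \<noteq> {})"
      proof (cases "T \<inter> (S - {v}) = {}")
        case True
        have "card (S \<union> T - {v}) = card (S - {v}) + card (T - {v})"
          unfolding Un_Diff by (rule card_Un_disjoint) (use True fin in auto)
        then show ?thesis unfolding pr c by (simp add: power_add power2_eq_square)
      next
        case False
        then show ?thesis using q unfolding pr by (simp add: power_le_one add_increasing)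
      qed
    qed
    also have "\<dots> = s\<^sup>2 * (q ^ (k - 1))\<^sup>2 + (\<Sum>S\<in>F. real (card {T \<in> F. T \<inter> (S - {v}) \<noteq> {}}))"
      using fF by (simp add: sum.distrib of_bool_def sum.If_cases Int_def s power2_eq_square)
    also have "(\<Sum>S\<in>F. real (card {T \<in> F. T \<inter> (S - {v}) \<noteq> {}})) \<le> (\<Sum>S\<in>F. real (D * k))"
    proof (rule sum_mono)
      fix S assume S: "S \<in> F"
      then have S': "S \<in> H" "v \<in> S" unfolding F_def by auto
      have "card {T \<in> F. T \<inter> (S - {v}) \<noteq> {}} \<le> card {T \<in> H. v \<in> T \<and> T \<inter> (S - {v}) \<noteq> {}}"
        by (rule card_mono) (use finite_H F_def in auto)
      also have "\<dots> \<le> D * card S"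
        by (rule card_edges_containing_two_le) (use S' finite_edge in auto)
      finally show "real (card {T \<in> F. T \<inter> (S - {v}) \<noteq> {}}) \<le> real (D * k)"
        using edge_card[OF S'(1)] by (simp flip: of_nat_mult)
    qed
    finally show ?thesis by (simp add: s mult_ac)
  qed
  have "?E (\<lambda>A. (?Y A - s * q ^ (k - 1))\<^sup>2)
      = ?E (\<lambda>A. (?Y A)\<^sup>2 - 2 * (s * q ^ (k - 1)) * ?Y A + (s * q ^ (k - 1))\<^sup>2)"
    by (simp only: power2_diff) (simp add: algebra_simps)
  also have "\<dots> = ?E (\<lambda>A. (?Y A)\<^sup>2) - 2 * (s * q ^ (k - 1)) * ?E ?Y + (s * q ^ (k - 1))\<^sup>2"
    using fU by simp
  also have "\<dots> = ?E (\<lambda>A. (?Y A)\<^sup>2) - s\<^sup>2 * (q ^ (k - 1))\<^sup>2"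
    unfolding EY by (simp add: power2_eq_square algebra_simps)
  finally show ?thesis unfolding Y using EY2 by linarith
qed

text \<open>Chebyshev's inequality at half the mean of the degree. The exponent
  \<open>2 * k - 1\<close> consists of two factors \<open>q ^ (k - 1)\<close> from the squared mean
  and one factor \<open>q\<close> for the failure probability.\<close>

lemma prob_low_degree_le:
  fixes q d :: real
  assumes q: "0 < q" "q < 1" and U: "U \<subseteq> V" and v: "v \<in> U"
    and d: "0 < d" "4 * k * D \<le> q ^ (2 * k - 1) * d" "d \<le> degree_in U v"
  shows "measure_pmf.prob (binomial_subset U q) {A. A \<subseteq> U \<and> degree_in A v < q ^ (k - 1) / 2 * d} \<le> q"
proof -
  let ?R = "binomial_subset U q"
  let ?E = "measure_pmf.expectation ?R"
  define F where "F = {S \<in> H. v \<in> S \<and> S - {v} \<subseteq> U}"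
  define s where "s = real (degree_in U v)"
  let ?Y = "\<lambda>A. real (card {S \<in> F. S - {v} \<subseteq> A})"
  let ?B = "\<lambda>A. A \<subseteq> U \<and> degree_in A v < q ^ (k - 1) / 2 * d"
  have fU: "finite U" using U finite_V finite_subset by blast
  have s: "d \<le> s" "0 < s" using d unfolding s_def by auto
  define r where "r = s * q ^ (k - 1)"
  have r: "0 < r" unfolding r_def using s q by simp
  have "(r / 2)\<^sup>2 * measure_pmf.prob ?R {A. ?B A} = ?E (\<lambda>A. (r / 2)\<^sup>2 * of_bool (?B A))"
    by (simp only: integral_mult_right_zero expectation_of_bool)
  also have "\<dots> \<le> ?E (\<lambda>A. (?Y A - r)\<^sup>2)"
  proof (rule integral_mono)
    fix A
    show "(r / 2)\<^sup>2 * of_bool (?B A) \<le> (?Y A - r)\<^sup>2"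
    proof (cases "?B A")
      case True
      then have "{S \<in> F. S - {v} \<subseteq> A} = {S \<in> H. v \<in> S \<and> S - {v} \<subseteq> A}"
        unfolding F_def by blast
      then have "?Y A = degree_in A v" unfolding degree_in_def by simp
      also have "\<dots> \<le> q ^ (k - 1) / 2 * s"
        using True mult_left_mono[OF s(1), of "q ^ (k - 1) / 2"] q by (smt (verit) divide_nonneg_nonneg zero_le_power)
      finally have "r / 2 \<le> r - ?Y A" by (simp add: r_def mult.commute)
      then have "(r / 2)\<^sup>2 \<le> (r - ?Y A)\<^sup>2" using r by (intro power_mono) auto
      then show ?thesis using True by (simp add: power2_commute)
    next
      case False
      then show ?thesis by auto
    qed
  qed (use fU in auto)
  also have "\<dots> \<le> s * k * D"
    unfolding r_def s_def F_def by (rule degree_in_second_moment) (use q U v in auto)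
  also have "\<dots> \<le> s * (q ^ (2 * k - 1) * s / 4)"
  proof -
    have "4 * k * D \<le> q ^ (2 * k - 1) * s"
      using d(2) mult_left_mono[OF s(1), of "q ^ (2 * k - 1)"] q by (smt (verit) zero_le_power)
    then show ?thesis using s by (simp add: mult.assoc)
  qed
  also have "\<dots> = (r / 2)\<^sup>2 * q"
  proof -
    have "2 * k - 1 = (k - 1) + (k - 1) + 1" using k_ge_3 by simp
    then have "q ^ (2 * k - 1) = q ^ (k - 1) * q ^ (k - 1) * q" by (simp only: power_add power_one_right)
    then show ?thesis by (simp add: r_def power2_eq_square)
  qed
  finally show ?thesis using r by simp
qed

text \<open>First moment argument: a random subset of density \<open>q\<close> and its set of
  low-degree vertices each have expected size at most \<open>q * card U\<close>. In some outcome
  \<open>A\<close> the total is at most the average; adding the low-degree vertices to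
  \<open>A\<close> makes every vertex left over a candidate.\<close>

lemma sparse_generator_exists:
  fixes q d :: real
  assumes q: "0 < q" "q < 1" and U: "U \<subseteq> V" "U \<noteq> {}"
    and d: "0 < d" "4 * k * D \<le> q ^ (2 * k - 1) * d" "\<And>v. v \<in> U \<Longrightarrow> d \<le> degree_in U v"
  obtains W where "W \<subseteq> U" "card W \<le> 2 * q * card U" "U - W \<subseteq> candidates (q ^ (k - 1) / 2 * d) W"
proof -
  let ?R = "binomial_subset U q"
  let ?E = "measure_pmf.expectation ?R"
  have fU: "finite U" using U finite_V finite_subset by blast
  let ?B = "\<lambda>A v. A \<subseteq> U \<and> degree_in A v < q ^ (k - 1) / 2 * d"
  let ?f = "\<lambda>A. real (card (A \<inter> U)) + (\<Sum>v\<in>U. of_bool (?B A v))"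
  have "?E ?f = q * card U + (\<Sum>v\<in>U. measure_pmf.prob ?R {A. ?B A v})"
    using fU q by (simp only: Bochner_Integration.integral_add integrable_binomial_subset expectation_sum_of_bool expectation_card less_imp_le)
  also have "(\<Sum>v\<in>U. measure_pmf.prob ?R {A. ?B A v}) \<le> (\<Sum>v\<in>U. q)"
    by (rule sum_mono, rule prob_low_degree_le) (use q U d in auto)
  finally have Ef: "?E ?f \<le> 2 * q * card U" by simp
  have "\<exists>A\<in>set_pmf ?R. ?f A \<le> 2 * q * card U"
  proof (rule ccontr)
    assume "\<not> ?thesis"
    then have "AE A in ?R. 2 * q * card U < ?f A"
      by (auto simp: AE_measure_pmf_iff not_le)
    then have "2 * q * card U < ?E ?f"
      using fU by (intro measure_pmf.expectation_greater) auto
    with Ef show False by simp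
  qed
  then obtain A where A: "A \<in> set_pmf ?R" "?f A \<le> 2 * q * card U" by blast
  have AU: "A \<subseteq> U" using A(1) set_binomial_subset by blast
  define W where "W = A \<union> {v \<in> U. ?B A v}"
  show thesis
  proof (rule that)
    show "W \<subseteq> U" using AU W_def by auto
    have "card W \<le> card A + card {v \<in> U. ?B A v}" unfolding W_def by (rule card_Un_le)
    also have "real \<dots> = ?f A"
    proof -
      have "A \<inter> U = A" "U \<inter> {v. ?B A v} = {v \<in> U. ?B A v}" using AU by auto
      then show ?thesis using fU by (simp add: of_bool_def sum.If_cases)
    qed
    finally show "card W \<le> 2 * q * card U" using A(2) by linarith
    show "U - W \<subseteq> candidates (q ^ (k - 1) / 2 * d) W"
    proof
      fix v assume v: "v \<in> U - W"
      then have "q ^ (k - 1) / 2 * d \<le> degree_in A v" using AU W_def by auto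
      moreover have "degree_in A v \<le> degree_in W v" by (rule degree_in_mono) (auto simp: W_def)
      ultimately show "v \<in> candidates (q ^ (k - 1) / 2 * d) W"
        using v U by (auto simp: candidates_def)
    qed
  qed
qed

end

section \<open>Counting cores, and the union bound over them\<close>

lemma sum_power_card_Pow:
  fixes z :: "'b :: comm_semiring_1"
  assumes "finite A"
  shows "(\<Sum>W\<in>Pow A. z ^ card W) = (1 + z) ^ card A"
  using prod_add[OF assms, of "\<lambda>_. z" "\<lambda>_. 1"] by (simp add: add.commute)

lemma sum_power_card_Pow_le_exp:
  fixes z :: real
  assumes "finite A" "0 \<le> z"
  shows "(\<Sum>W\<in>Pow A. z ^ card W) \<le> exp (z * card A)"
proof -
  have "(1 + z) ^ card A \<le> exp z ^ card A"
    using assms by (intro power_mono) auto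
  then show ?thesis using assms by (simp add: sum_power_card_Pow mult.commute flip: exp_of_nat_mult)
qed

context codegree_hypergraph
begin

definition cores :: "real \<Rightarrow> nat \<Rightarrow> 'a set set" where
  "cores d m = {U. U \<subseteq> V \<and> card U = m \<and> (\<forall>v\<in>U. d \<le> degree_in U v)}"

lemma finite_cores: "finite (cores d m)"
  by (rule finite_subset[of _ "Pow V"]) (use finite_V cores_def in auto)

text \<open>The factors \<open>(1 / z) powr _ * z ^ _\<close> and \<open>(1 / x) ^ _ * x ^ _\<close> are at least 1 on the sets that are
  counted, which replaces estimates of binomial coefficients by the binomial theorem.\<close>

lemma card_cores_le:
  fixes q d z x c :: real
  assumes q: "0 < q" "q < 1" and d: "0 < d" "4 * k * D \<le> q ^ (2 * k - 1) * d"
    and z: "0 < z" "z \<le> 1" and x: "0 < x" "x \<le> 1" and m: "0 < m"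
    and c: "\<And>W. W \<subseteq> V \<Longrightarrow> card W \<le> 2 * q * m \<Longrightarrow> card (candidates (q ^ (k - 1) / 2 * d) W) \<le> c"
  shows "card (cores d m) \<le> (1 / z) powr (2 * q * m) * exp (z * card V) * ((1 / x) ^ m * exp (x * c))"
proof -
  let ?C = "candidates (q ^ (k - 1) / 2 * d)"
  let ?Ws = "{W \<in> Pow V. card W \<le> 2 * q * m}"
  let ?Vs = "\<lambda>W. {T \<in> Pow (?C W). card T \<le> m}"
  have fC: "finite (?C W)" for W unfolding candidates_def using finite_V by auto
  have fWs: "finite ?Ws" using finite_V by auto
  have fVs: "finite (?Vs W)" for W using fC by auto
  \<comment> \<open>A core is encoded by its generator \<open>W\<close> and its remaining vertices,
    which are chosen among the candidates of \<open>W\<close> instead of all of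
    \<open>V\<close>.\<close>
  have "cores d m \<subseteq> (\<Union>W\<in>?Ws. (\<union>) W ` ?Vs W)"
  proof
    fix U assume U: "U \<in> cores d m"
    then have U': "U \<subseteq> V" "card U = m" "\<And>v. v \<in> U \<Longrightarrow> d \<le> degree_in U v" "U \<noteq> {}"
      using m unfolding cores_def by auto
    obtain W where W: "W \<subseteq> U" "card W \<le> 2 * q * card U" "U - W \<subseteq> ?C W"
      using sparse_generator_exists[OF q U'(1,4) d U'(3)] by blast
    have "card (U - W) \<le> m"
      using U' W(1) finite_V by (metis Diff_subset card_mono finite_subset)
    then have "U - W \<in> ?Vs W" using W by auto
    moreover have "W \<in> ?Ws" using W U' by auto
    moreover have "U = W \<union> (U - W)" using W(1) by auto
    ultimately show "U \<in> (\<Union>W\<in>?Ws. (\<union>) W ` ?Vs W)" by blast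
  qed
  then have "card (cores d m) \<le> card (\<Union>W\<in>?Ws. (\<union>) W ` ?Vs W)"
    by (rule card_mono[rotated]) (use fWs fVs in auto)
  also have "\<dots> \<le> (\<Sum>W\<in>?Ws. card (?Vs W))"
    by (rule order.trans[OF card_UN_le[OF fWs] sum_mono]) (rule card_image_le[OF fVs])
  finally have "real (card (cores d m)) \<le> (\<Sum>W\<in>?Ws. real (card (?Vs W)))"
    by (simp flip: of_nat_sum)
  also have "\<dots> \<le> (\<Sum>W\<in>?Ws. ((1 / z) powr (2 * q * m) * z ^ card W) * ((1 / x) ^ m * exp (x * c)))"
  proof (rule sum_mono)
    fix W assume W: "W \<in> ?Ws"
    have "real (card (?Vs W)) = (\<Sum>T\<in>?Vs W. 1)" by simp
    also have "\<dots> \<le> (\<Sum>T\<in>?Vs W. (1 / x) ^ m * x ^ card T)"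
    proof (rule sum_mono)
      fix T assume "T \<in> ?Vs W"
      then have "x ^ m \<le> x ^ card T" using x by (intro power_decreasing) auto
      then show "1 \<le> (1 / x) ^ m * x ^ card T" using x by (simp add: power_divide)
    qed
    also have "\<dots> \<le> (\<Sum>T\<in>Pow (?C W). (1 / x) ^ m * x ^ card T)"
      by (rule sum_mono2) (use fC x in auto)
    also have "\<dots> = (1 / x) ^ m * (\<Sum>T\<in>Pow (?C W). x ^ card T)"
      by (simp add: sum_distrib_left)
    also have "\<dots> \<le> (1 / x) ^ m * exp (x * c)"
    proof (rule mult_left_mono)
      have "(\<Sum>T\<in>Pow (?C W). x ^ card T) \<le> exp (x * card (?C W))"
        by (rule sum_power_card_Pow_le_exp) (use fC x in auto)
      also have "\<dots> \<le> exp (x * c)" using c[of W] W x by simp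
      finally show "(\<Sum>T\<in>Pow (?C W). x ^ card T) \<le> exp (x * c)" .
    qed (use x in simp)
    finally have 1: "real (card (?Vs W)) \<le> (1 / x) ^ m * exp (x * c)" .
    have "z powr (2 * q * m) \<le> z powr (card W)"
      using W z by (intro powr_mono') auto
    then have "1 \<le> (1 / z) powr (2 * q * m) * z ^ card W"
      using z by (simp add: powr_divide powr_realpow)
    then have "1 * ((1 / x) ^ m * exp (x * c))
        \<le> ((1 / z) powr (2 * q * m) * z ^ card W) * ((1 / x) ^ m * exp (x * c))"
      using x by (intro mult_right_mono) auto
    with 1 show "real (card (?Vs W))
        \<le> ((1 / z) powr (2 * q * m) * z ^ card W) * ((1 / x) ^ m * exp (x * c))" by linarith
  qed
  also have "\<dots> \<le> (\<Sum>W\<in>Pow V. ((1 / z) powr (2 * q * m) * z ^ card W) * ((1 / x) ^ m * exp (x * c)))"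
    by (rule sum_mono2) (use finite_V x z in auto)
  also have "\<dots> = (1 / z) powr (2 * q * m) * (\<Sum>W\<in>Pow V. z ^ card W) * ((1 / x) ^ m * exp (x * c))"
    by (simp only: sum_distrib_left sum_distrib_right)
  also have "\<dots> \<le> (1 / z) powr (2 * q * m) * exp (z * card V) * ((1 / x) ^ m * exp (x * c))"
    using sum_power_card_Pow_le_exp[OF finite_V, of z] x z
    by (intro mult_right_mono mult_left_mono) auto
  finally show ?thesis .
qed

text \<open>A seed induces at least \<open>M\<close> edges, and a core inside it keeps
  \<open>M / 2\<close> of them because the deletions cost at most \<open>d * b\<close>. As
  \<open>m\<close> vertices induce at most \<open>D * m\<^sup>2\<close> edges, the core has at least
  \<open>sqrt (M / (2 * D))\<close> vertices. The union bound over cores is a geometric series with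
  ratio \<open>r \<le> 1 / 2\<close>, hence the factor 2.\<close>

lemma prob_seed_le:
  fixes p d r \<theta> M :: real
  assumes p: "0 \<le> p" "p \<le> 1" and d: "0 \<le> d" "2 * d * b \<le> M" and M: "0 < M"
    and r: "0 < r" "r \<le> 1 / 2"
    and seed: "\<And>U. U \<subseteq> V \<Longrightarrow> card U \<le> b \<Longrightarrow> \<theta> < cond_mean p U \<Longrightarrow> M \<le> induced U"
    and core: "\<And>m. sqrt (M / (2 * D)) \<le> m \<Longrightarrow> 0 < m \<Longrightarrow> m \<le> b \<Longrightarrow> card (cores d m) * p ^ m \<le> r ^ m"
  shows "measure_pmf.prob (binomial_subset V p) {A. \<not> seedless p \<theta> b A} \<le> 2 * r powr sqrt (M / (2 * D))"
proof -
  let ?R = "binomial_subset V p"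
  define m0 where "m0 = nat \<lceil>sqrt (M / (2 * D))\<rceil>"
  \<comment> \<open>\<open>D = 0\<close> is allowed in this locale and would give
    \<open>m0 = 0\<close>, whereas \<open>core\<close> speaks of \<open>0 < m\<close> only.\<close>
  let ?I = "{m0..b} - {0}"
  have "measure_pmf.prob ?R {A. \<not> seedless p \<theta> b A} = measure_pmf.prob ?R ({A. \<not> seedless p \<theta> b A} \<inter> set_pmf ?R)"
    by (rule measure_Int_set_pmf[symmetric])
  also have "\<dots> \<le> measure_pmf.prob ?R (\<Union>m\<in>?I. \<Union>U\<in>cores d m. {A. U \<subseteq> A})"
  proof (rule measure_pmf.finite_measure_mono)
    show "{A. \<not> seedless p \<theta> b A} \<inter> set_pmf ?R \<subseteq> (\<Union>m\<in>?I. \<Union>U\<in>cores d m. {A. U \<subseteq> A})"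
    proof
      fix A assume A: "A \<in> {A. \<not> seedless p \<theta> b A} \<inter> set_pmf ?R"
      then have "A \<subseteq> V" using set_binomial_subset by blast
      with A obtain U where U: "U \<subseteq> A" "card U \<le> b" "\<theta> < cond_mean p U" "U \<subseteq> V"
        unfolding seedless_def by (auto simp: not_le)
      have fU: "finite U" using U(4) finite_V finite_subset by blast
      obtain U' where U': "U' \<subseteq> U" "real (induced U) - d * card U \<le> real (induced U') - d * card U'"
        "\<And>v. v \<in> U' \<Longrightarrow> d \<le> degree_in U' v" using core_exists[OF fU] by blast
      have fU': "finite U'" using fU U'(1) finite_subset by blast
      have "M \<le> induced U" using seed U by blast
      moreover have "d * card U \<le> d * b" using d U(2) by (intro mult_left_mono) auto
      moreover have "0 \<le> d * card U'" using d by simp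
      ultimately have "M / 2 \<le> induced U'" using U'(2) d by linarith
      moreover have "real (induced U') \<le> D * (card U')\<^sup>2"
        using induced_le[OF fU'] by (simp flip: of_nat_mult of_nat_power)
      ultimately have M2: "M / 2 \<le> D * (card U')\<^sup>2" by linarith
      then have "0 < D" using M by (cases "D = 0") auto
      then have "M / (2 * D) \<le> (card U')\<^sup>2" using M2 by (simp add: field_simps)
      then have "sqrt (M / (2 * D)) \<le> card U'" by (simp add: real_le_lsqrt)
      then have "m0 \<le> card U'" unfolding m0_def by linarith
      moreover have "card U' \<noteq> 0" using M2 M by (cases "card U' = 0") auto
      moreover have "card U' \<le> b" using card_mono[OF fU U'(1)] U(2) by linarith
      ultimately have "card U' \<in> ?I" by simp
      moreover have "U' \<in> cores d (card U')" unfolding cores_def using U' U by auto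
      ultimately show "A \<in> (\<Union>m\<in>?I. \<Union>U\<in>cores d m. {A. U \<subseteq> A})" using U' U by blast
    qed
  qed auto
  also have "\<dots> \<le> (\<Sum>m\<in>?I. measure_pmf.prob ?R (\<Union>U\<in>cores d m. {A. U \<subseteq> A}))"
    by (rule measure_pmf.finite_measure_subadditive_finite) auto
  also have "\<dots> \<le> (\<Sum>m\<in>?I. r ^ m)"
  proof (rule sum_mono)
    fix m assume m: "m \<in> ?I"
    have "measure_pmf.prob ?R (\<Union>U\<in>cores d m. {A. U \<subseteq> A}) \<le> (\<Sum>U\<in>cores d m. measure_pmf.prob ?R {A. U \<subseteq> A})"
      by (rule measure_pmf.finite_measure_subadditive_finite) (use finite_cores in auto)
    also have "\<dots> = (\<Sum>U\<in>cores d m. p ^ m)"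
      using prob_superset[OF finite_V _ p] by (intro sum.cong) (auto simp: cores_def)
    also have "\<dots> \<le> r ^ m" using core[of m] m by (auto simp: m0_def)
    finally show "measure_pmf.prob ?R (\<Union>U\<in>cores d m. {A. U \<subseteq> A}) \<le> r ^ m" .
  qed
  also have "\<dots> \<le> (\<Sum>m\<in>(+) m0 ` {..b}. r ^ m)"
  proof (rule sum_mono2)
    show "?I \<subseteq> (+) m0 ` {..b}"
    proof
      fix m assume "m \<in> ?I"
      then have "m = m0 + (m - m0)" "m - m0 \<le> b" by auto
      then show "m \<in> (+) m0 ` {..b}" by blast
    qed
  qed (use r in auto)
  also have "\<dots> = r ^ m0 * (\<Sum>m\<le>b. r ^ m)"
    by (subst sum.reindex) (auto simp: power_add sum_distrib_left)
  also have "\<dots> \<le> r ^ m0 * 2"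
  proof (rule mult_left_mono)
    have "(\<Sum>m\<le>b. r ^ m) \<le> (\<Sum>m. r ^ m)"
      by (rule sum_le_suminf) (use r in \<open>auto intro: summable_geometric\<close>)
    also have "\<dots> = 1 / (1 - r)" using r by (intro suminf_geometric) auto
    also have "\<dots> \<le> 2" using r by (simp add: field_simps)
    finally show "(\<Sum>m\<le>b. r ^ m) \<le> 2" .
  qed (use r in auto)
  also have "\<dots> \<le> 2 * r powr sqrt (M / (2 * D))"
  proof -
    have "sqrt (M / (2 * D)) \<le> m0" unfolding m0_def by linarith
    then have "r powr m0 \<le> r powr sqrt (M / (2 * D))" using r by (intro powr_mono') auto
    then show ?thesis using r by (simp add: powr_realpow)
  qed
  finally show ?thesis .
qed

section \<open>Packings\<close>

definition blocked :: "'a set \<Rightarrow> 'a set" where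
  "blocked U = U \<union> \<Union>{S \<in> H. 2 \<le> card (S \<inter> U)}"

text \<open>Every new edge avoids \<^const>\<open>blocked\<close>, so that the union of the edges of a packing
  induces only linearly many edges.\<close>

primrec packings :: "nat \<Rightarrow> 'a set list set" where
  "packings 0 = {[]}"
| "packings (Suc r) = (\<lambda>(T, S). S # T) ` (SIGMA T:packings r. {S \<in> H. S \<inter> blocked (\<Union>(set T)) = {}})"

lemma finite_packings: "finite (packings r)"
  by (induction r) (use finite_H in auto)

text \<open>\<open>S # T\<close> determines both parts, so a sum over packings becomes an iterated
  sum over successive choices of edges.\<close>

lemma sum_packings_Suc:
  "(\<Sum>T\<in>packings (Suc r). f T)
    = (\<Sum>T\<in>packings r. \<Sum>S\<in>{S \<in> H. S \<inter> blocked (\<Union>(set T)) = {}}. f (S # T))"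
proof -
  have inj: "inj_on (\<lambda>(T, S). S # T) X" for X :: "('a set list \<times> 'a set) set"
    by (auto simp: inj_on_def)
  show ?thesis
    unfolding packings.simps sum.reindex[OF inj] using finite_packings finite_H
    by (subst sum.Sigma) (auto intro!: sum.cong)
qed

lemma packings_edges: "T \<in> packings r \<Longrightarrow> set T \<subseteq> H"
proof (induction r arbitrary: T)
  case (Suc r)
  then obtain T' S where "T = S # T'" "T' \<in> packings r" "S \<in> H" by auto
  then show ?case using Suc.IH by simp
qed simp

lemma packings_subset: "T \<in> packings r \<Longrightarrow> \<Union>(set T) \<subseteq> V"
  using packings_edges[of T r] edge_subset by blast

lemma finite_packings_Union: "T \<in> packings r \<Longrightarrow> finite (\<Union>(set T))"
  by (rule finite_subset[OF packings_subset finite_V])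

lemma card_packings_Union: "T \<in> packings r \<Longrightarrow> card (\<Union>(set T)) = k * r"
proof (induction r arbitrary: T)
  case (Suc r)
  then obtain T' S where T: "T = S # T'" "T' \<in> packings r" "S \<in> H" "S \<inter> blocked (\<Union>(set T')) = {}"
    by auto
  then have "S \<inter> \<Union>(set T') = {}" unfolding blocked_def by blast
  then have "card (S \<union> \<Union>(set T')) = card S + card (\<Union>(set T'))"
    using finite_edge finite_packings_Union T by (intro card_Un_disjoint) auto
  then show ?case using T Suc.IH[OF T(2)] edge_card by simp
qed simp

lemma card_set_packings: "T \<in> packings r \<Longrightarrow> card (set T) = r"
proof (induction r arbitrary: T)
  case (Suc r)
  then obtain T' S where T: "T = S # T'" "T' \<in> packings r" "S \<in> H" "S \<inter> blocked (\<Union>(set T')) = {}"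
    by auto
  then have "S \<inter> \<Union>(set T') = {}" unfolding blocked_def by blast
  moreover have "S \<noteq> {}" using edge_card[OF T(3)] k_ge_3 by auto
  ultimately have "S \<notin> set T'" by blast
  then show ?case using T Suc.IH[OF T(2)] by simp
qed simp

text \<open>When \<open>S\<close> is added to \<open>U\<close>, every new edge \<open>R\<close>
  meets \<open>S\<close> at least twice: with a single vertex in \<open>S\<close> it would have at
  least \<open>k - 1 \<ge> 2\<close> vertices in \<open>U\<close> and hence lie in
  \<open>blocked U\<close>, which \<open>S\<close> avoids. So each step adds at most
  \<open>D * k\<^sup>2\<close> edges.\<close>

lemma induced_packings_le: "T \<in> packings r \<Longrightarrow> induced (\<Union>(set T)) \<le> r * (D * k\<^sup>2)"
proof (induction r arbitrary: T)
  case 0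
  then show ?case using edge_card[of "{}"] k_ge_3 by (auto simp: induced_def card_eq_0_iff finite_H)
next
  case (Suc r)
  then obtain T' S where T: "T = S # T'" "T' \<in> packings r" "S \<in> H" "S \<inter> blocked (\<Union>(set T')) = {}"
    by auto
  define U where "U = \<Union>(set T')"
  have fin: "finite U" "finite S" using finite_packings_Union[OF T(2)] finite_edge[OF T(3)] by (auto simp: U_def)
  have "{R \<in> H. R \<subseteq> S \<union> U} \<subseteq> {R \<in> H. R \<subseteq> U} \<union> {R \<in> H. 2 \<le> card (R \<inter> S)}"
  proof
    fix R assume R: "R \<in> {R \<in> H. R \<subseteq> S \<union> U}"
    show "R \<in> {R \<in> H. R \<subseteq> U} \<union> {R \<in> H. 2 \<le> card (R \<inter> S)}"
    proof (rule ccontr)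
      assume neg: "R \<notin> {R \<in> H. R \<subseteq> U} \<union> {R \<in> H. 2 \<le> card (R \<inter> S)}"
      then have "card (R \<inter> S) < 2" "R \<inter> S \<noteq> {}" using R by auto
      have "card R = card ((R \<inter> S) \<union> (R \<inter> U))" using R by (intro arg_cong[where f = card]) auto
      also have "\<dots> \<le> card (R \<inter> S) + card (R \<inter> U)" by (rule card_Un_le)
      finally have "k \<le> card (R \<inter> S) + card (R \<inter> U)" using R edge_card by simp
      with \<open>card (R \<inter> S) < 2\<close> have "2 \<le> card (R \<inter> U)" using k_ge_3 by linarith
      then have "R \<subseteq> blocked U" using R unfolding blocked_def by blast
      with T(4) \<open>R \<inter> S \<noteq> {}\<close> show False unfolding U_def by blast
    qed
  qed
  then have "induced (S \<union> U) \<le> card ({R \<in> H. R \<subseteq> U} \<union> {R \<in> H. 2 \<le> card (R \<inter> S)})"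
    unfolding induced_def by (rule card_mono[rotated]) (use finite_H in auto)
  also have "\<dots> \<le> induced U + card {R \<in> H. 2 \<le> card (R \<inter> S)}"
    unfolding induced_def by (rule card_Un_le)
  also have "\<dots> \<le> r * (D * k\<^sup>2) + D * k\<^sup>2"
    using Suc.IH[OF T(2)] card_meeting_twice_le[OF fin(2)] edge_card[OF T(3)] unfolding U_def by simp
  finally show ?case using T(1) U_def by simp
qed

lemma card_blocked_le:
  assumes "U \<subseteq> V"
  shows "card (blocked U) \<le> card U + D * (card U)\<^sup>2 * k"
proof -
  have fU: "finite U" using assms finite_V finite_subset by blast
  have "card (blocked U) \<le> card U + card (\<Union>{S \<in> H. 2 \<le> card (S \<inter> U)})"
    unfolding blocked_def by (rule card_Un_le)
  also have "card (\<Union>{S \<in> H. 2 \<le> card (S \<inter> U)}) \<le> (\<Sum>S\<in>{S \<in> H. 2 \<le> card (S \<inter> U)}. card S)"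
    by (rule card_Union_le_sum_card)
  also have "\<dots> = card {S \<in> H. 2 \<le> card (S \<inter> U)} * k"
    using edge_card by simp
  also have "\<dots> \<le> D * (card U)\<^sup>2 * k"
    by (rule mult_right_mono[OF card_meeting_twice_le[OF fU]]) simp
  finally show ?thesis by simp
qed

text \<open>The condition \<open>room\<close> ensures that at most half of all edges meet the
  blocked set, so each extension has at least \<open>card H / 2\<close> choices. Packings are
  ordered lists, so these numbers simply multiply.\<close>

lemma card_packings_ge:
  assumes room: "2 * ((k * R + D * (k * R)\<^sup>2 * k) * D * card V) \<le> card H" and "r \<le> R"
  shows "(card H / 2) ^ r \<le> card (packings r)"
  using assms(2)
proof (induction r)
  case (Suc r)
  have "(card H / 2) ^ Suc r \<le> card (packings r) * (card H / 2)"
    using Suc by (simp add: mult.commute mult_left_mono)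
  also have "\<dots> = (\<Sum>T\<in>packings r. card H / 2)" by simp
  also have "\<dots> \<le> (\<Sum>T\<in>packings r. real (card {S \<in> H. S \<inter> blocked (\<Union>(set T)) = {}}))"
  proof (rule sum_mono)
    fix T assume T: "T \<in> packings r"
    let ?B = "blocked (\<Union>(set T))"
    have "?B \<subseteq> V" using packings_subset[OF T] edge_subset by (auto simp: blocked_def)
    then have "card {S \<in> H. S \<inter> ?B \<noteq> {}} \<le> card ?B * D * card V" by (rule card_meeting_le)
    also have "card ?B \<le> k * r + D * (k * r)\<^sup>2 * k"
      using card_blocked_le[OF packings_subset[OF T]] card_packings_Union[OF T] by simp
    also have "\<dots> \<le> k * R + D * (k * R)\<^sup>2 * k"
      using Suc.prems by (intro add_mono mult_right_mono mult_left_mono power_mono) auto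
    finally have "2 * card {S \<in> H. S \<inter> ?B \<noteq> {}} \<le> card H"
      using room by (meson le_trans mult_le_mono1 mult_le_mono2 order_refl)
    moreover have "card H = card {S \<in> H. S \<inter> ?B = {}} + card {S \<in> H. S \<inter> ?B \<noteq> {}}"
      using finite_H by (subst card_Un_disjoint[symmetric]) (auto intro!: arg_cong[where f = card])
    ultimately show "card H / 2 \<le> real (card {S \<in> H. S \<inter> ?B = {}})" by simp
  qed
  also have "\<dots> = card (packings (Suc r))"
    using sum_packings_Suc[where f = "\<lambda>_. 1 :: real" and r = r] by simp
  finally show ?case .
qed simp

text \<open>The edges of a packing are disjoint, so the weight is a product over edges. Dropping the
  avoidance condition bounds the sum over each edge by \<open>cond_mean p U\<close>.\<close>

lemma sum_packings_le:
  fixes p :: real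
  assumes "0 \<le> p"
  shows "(\<Sum>T\<in>packings r. p ^ card (\<Union>(set T) - U)) \<le> cond_mean p U ^ r"
proof (induction r)
  case (Suc r)
  have "(\<Sum>T\<in>packings (Suc r). p ^ card (\<Union>(set T) - U))
      = (\<Sum>T\<in>packings r. \<Sum>S\<in>{S \<in> H. S \<inter> blocked (\<Union>(set T)) = {}}. p ^ card (S - U) * p ^ card (\<Union>(set T) - U))"
    unfolding sum_packings_Suc
  proof (intro sum.cong refl)
    fix T S assume T: "T \<in> packings r" and S: "S \<in> {S \<in> H. S \<inter> blocked (\<Union>(set T)) = {}}"
    then have "S \<inter> \<Union>(set T) = {}" unfolding blocked_def by blast
    then have "card ((S - U) \<union> (\<Union>(set T) - U)) = card (S - U) + card (\<Union>(set T) - U)"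
      using S finite_edge finite_packings_Union[OF T] by (intro card_Un_disjoint) auto
    then show "p ^ card (\<Union>(set (S # T)) - U) = p ^ card (S - U) * p ^ card (\<Union>(set T) - U)"
      by (simp add: Un_Diff power_add)
  qed
  also have "\<dots> \<le> (\<Sum>T\<in>packings r. \<Sum>S\<in>H. p ^ card (S - U) * p ^ card (\<Union>(set T) - U))"
    by (intro sum_mono sum_mono2) (use finite_H assms in auto)
  also have "\<dots> = cond_mean p U * (\<Sum>T\<in>packings r. p ^ card (\<Union>(set T) - U))"
    unfolding cond_mean_def sum_product by (rule sum.swap)
  also have "\<dots> \<le> cond_mean p U * cond_mean p U ^ r"
    by (intro mult_left_mono Suc.IH cond_mean_nonneg assms)
  finally show ?case by simp
qed simp

text \<open>Second moment of the number \<open>Z\<close> of packings contained in the random set.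
  For a fixed packing \<open>T\<close> the sum over \<open>T'\<close> is the conditional expectation
  of \<open>Z\<close> given that the union of \<open>T\<close> is present, at most
  \<open>G ^ r\<close>. The result is the first moment divided by \<open>G ^ r\<close>.\<close>

lemma prob_many_edges_ge:
  fixes p G :: real
  assumes p: "0 < p" "p \<le> 1" and H: "H \<noteq> {}"
    and room: "2 * ((k * r + D * (k * r)\<^sup>2 * k) * D * card V) \<le> card H"
    and G: "0 < G" "\<And>U. U \<subseteq> V \<Longrightarrow> card U = k * r \<Longrightarrow> induced U \<le> r * (D * k\<^sup>2) \<Longrightarrow> cond_mean p U \<le> G"
  shows "(card H * p ^ k / (2 * G)) ^ r \<le> measure_pmf.prob (binomial_subset V p) {A. r \<le> induced A}"
proof -
  let ?R = "binomial_subset V p"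
  let ?E = "measure_pmf.expectation ?R"
  let ?U = "\<lambda>T. \<Union>(set T)"
  define Z where "Z A = (\<Sum>T\<in>packings r. of_bool (?U T \<subseteq> A) :: real)" for A
  define a where "a = card (packings r) * p ^ (k * r)"
  have p': "0 \<le> p" using p by simp
  have cH: "0 < card H" using H finite_H by (simp add: card_gt_0_iff)
  have many: "(card H / 2) ^ r \<le> card (packings r)" using card_packings_ge[OF room] by simp
  moreover have "0 < (card H / 2) ^ r" using cH by simp
  ultimately have "0 < card (packings r)" by linarith
  then have a: "0 < a" using p by (simp add: a_def)
  have EZ: "?E Z = a"
  proof -
    have "?E Z = (\<Sum>T\<in>packings r. measure_pmf.prob ?R {A. ?U T \<subseteq> A})"
      unfolding Z_def by (rule expectation_sum_of_bool[OF finite_V])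
    also have "\<dots> = (\<Sum>T\<in>packings r. p ^ (k * r))"
      using prob_superset[OF finite_V packings_subset p' p(2)] card_packings_Union by (intro sum.cong) auto
    finally show ?thesis by (simp add: a_def)
  qed
  have EZ2: "?E (\<lambda>A. (Z A)\<^sup>2) \<le> a * G ^ r"
  proof -
    have sq: "(\<lambda>A. (Z A)\<^sup>2) = (\<lambda>A. \<Sum>T\<in>packings r. \<Sum>T'\<in>packings r. of_bool (?U T \<union> ?U T' \<subseteq> A))"
      by (rule ext, unfold Z_def power2_eq_square sum_product, intro sum.cong) auto
    have "?E (\<lambda>A. (Z A)\<^sup>2) = (\<Sum>T\<in>packings r. ?E (\<lambda>A. \<Sum>T'\<in>packings r. of_bool (?U T \<union> ?U T' \<subseteq> A)))"
      unfolding sq using finite_V by (intro Bochner_Integration.integral_sum) simp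
    also have "\<dots> = (\<Sum>T\<in>packings r. \<Sum>T'\<in>packings r. measure_pmf.prob ?R {A. ?U T \<union> ?U T' \<subseteq> A})"
      by (simp only: expectation_sum_of_bool[OF finite_V])
    also have "\<dots> = (\<Sum>T\<in>packings r. \<Sum>T'\<in>packings r. p ^ (k * r) * p ^ card (?U T' - ?U T))"
    proof (intro sum.cong refl)
      fix T T' assume T: "T \<in> packings r" "T' \<in> packings r"
      have "card (?U T \<union> ?U T') = card (?U T) + card (?U T' - ?U T)"
        using finite_packings_Union[OF T(1)] finite_packings_Union[OF T(2)]
        by (subst card_Un_disjoint[symmetric]) auto
      then show "measure_pmf.prob ?R {A. ?U T \<union> ?U T' \<subseteq> A} = p ^ (k * r) * p ^ card (?U T' - ?U T)"
        using prob_superset[OF finite_V, of "?U T \<union> ?U T'" p] packings_subset T p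
        by (simp add: card_packings_Union power_add del: Un_subset_iff)
    qed
    also have "\<dots> = (\<Sum>T\<in>packings r. p ^ (k * r) * (\<Sum>T'\<in>packings r. p ^ card (?U T' - ?U T)))"
      by (simp add: sum_distrib_left)
    also have "\<dots> \<le> (\<Sum>T\<in>packings r. p ^ (k * r) * G ^ r)"
    proof (intro sum_mono mult_left_mono)
      fix T assume T: "T \<in> packings r"
      have "(\<Sum>T'\<in>packings r. p ^ card (?U T' - ?U T)) \<le> cond_mean p (?U T) ^ r"
        by (rule sum_packings_le[OF p'])
      also have "\<dots> \<le> G ^ r"
        using G(2)[of "?U T"] packings_subset[OF T] card_packings_Union[OF T] induced_packings_le[OF T]
        by (intro power_mono cond_mean_nonneg p') auto
      finally show "(\<Sum>T'\<in>packings r. p ^ card (?U T' - ?U T)) \<le> G ^ r" .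
    qed (use p' in simp)
    finally show ?thesis by (simp add: a_def)
  qed
  have "(card H * p ^ k / (2 * G)) ^ r = (card H / 2) ^ r * p ^ (k * r) / G ^ r"
    by (simp add: power_divide power_mult_distrib power_mult)
  also have "\<dots> \<le> a / G ^ r"
    using many p G unfolding a_def by (intro divide_right_mono mult_right_mono) auto
  also have "\<dots> = (?E Z)\<^sup>2 / (a * G ^ r)" using a EZ by (simp add: power2_eq_square)
  also have "\<dots> \<le> measure_pmf.prob ?R {A. Z A \<noteq> 0}"
  proof (rule second_moment_method)
    show "finite (set_pmf ?R)" by (rule finite_subset[OF set_binomial_subset]) (use finite_V in simp)
  qed (use a EZ EZ2 in auto)
  also have "\<dots> \<le> measure_pmf.prob ?R {A. r \<le> induced A}"
  proof (rule measure_pmf.finite_measure_mono)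
    show "{A. Z A \<noteq> 0} \<subseteq> {A. r \<le> induced A}"
    proof clarify
      fix A assume "Z A \<noteq> 0"
      then obtain T where T: "T \<in> packings r" "?U T \<subseteq> A"
        unfolding Z_def by (metis (mono_tags, lifting) of_bool_eq(1) sum.neutral)
      have "card (set T) \<le> induced A"
        unfolding induced_def by (rule card_mono) (use finite_H packings_edges[OF T(1)] T(2) in auto)
      then show "r \<le> induced A" using card_set_packings[OF T(1)] by simp
    qed
  qed auto
  finally show ?thesis .
qed

end

section \<open>Dense hypergraphs\<close>

lemma ln_inverse_le_powr:
  fixes p a :: real
  assumes "0 < p" "0 < a"
  shows "ln (1 / p) \<le> (1 / a) * p powr (- a)"
proof -
  have "a * ln (1 / p) = ln (p powr (- a))" using assms by (simp add: ln_powr ln_div)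
  also have "\<dots> \<le> p powr (- a) - 1" by (rule ln_le_minus_one) (use assms in simp)
  finally have "a * ln (1 / p) \<le> p powr (- a)" by simp
  then show ?thesis using assms by (simp add: field_simps)
qed

text \<open>Lets each spare factor \<open>sqrt p\<close> absorb one logarithm.\<close>

lemma ln_inverse_mult_sqrt_le:
  fixes p :: real
  assumes "0 < p"
  shows "ln (1 / p) * sqrt p \<le> 2"
proof -
  have "ln (1 / p) * sqrt p \<le> 2 * p powr (- (1 / 2)) * p powr (1 / 2)"
    using ln_inverse_le_powr[of p "1 / 2"] assms by (simp add: powr_half_sqrt mult_right_mono)
  also have "\<dots> = 2" using assms by (simp flip: powr_add)
  finally show ?thesis .
qed

locale dense_hypergraph = codegree_hypergraph +
  fixes \<gamma> :: real
  assumes V_nonempty: "V \<noteq> {}" and D_pos: "0 < D" and \<gamma>_pos: "0 < \<gamma>"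
    and dense: "\<gamma> * (card V)\<^sup>2 \<le> card H"
begin

definition mean :: "real \<Rightarrow> real" where
  "mean p = real (card H) * p ^ k"

lemma card_V_pos: "0 < card V"
  using V_nonempty finite_V by (simp add: card_gt_0_iff)

lemma card_H_pos: "0 < card H"
proof -
  have "0 < \<gamma> * (card V)\<^sup>2" using card_V_pos \<gamma>_pos by simp
  then have "0 < real (card H)" using dense by (rule less_le_trans)
  then show ?thesis by simp
qed

lemma card_H_le: "card H \<le> D * (card V)\<^sup>2"
proof -
  have "{S \<in> H. S \<inter> V \<noteq> {}} = H"
    using edge_subset edge_card k_ge_3 by (auto simp: Int_absorb2) (metis card.empty not_numeral_le_zero)
  then show ?thesis using card_meeting_le[of V] by (simp add: power2_eq_square mult_ac)
qed

lemma mean_pos: "0 < p \<Longrightarrow> 0 < mean p"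
  using card_H_pos by (simp add: mean_def)

lemma mean_ge:
  assumes "0 \<le> p"
  shows "\<gamma> * (card V)\<^sup>2 * p ^ k \<le> mean p"
  unfolding mean_def using assms dense by (intro mult_right_mono) auto

text \<open>Since \<open>2 * (k - 1) = k + (k - 2)\<close>, the square is at most
  \<open>mean p / \<gamma>\<close> times \<open>p ^ (k - 2)\<close>, and \<open>k \<ge> 3\<close>
  leaves a spare factor \<open>p\<close>.\<close>

lemma card_V_mult_power_le:
  fixes p :: real
  assumes p: "0 < p" "p \<le> 1"
  shows "card V * p ^ (k - 1) \<le> sqrt (mean p * p / \<gamma>)"
proof (rule real_le_rsqrt)
  have "2 * (k - 1) = k + (k - 2)" using k_ge_3 by simp
  then have "(card V * p ^ (k - 1))\<^sup>2 = (card V)\<^sup>2 * p ^ k * p ^ (k - 2)"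
    by (simp only: power_mult_distrib power_mult[symmetric] mult.commute[of "k - 1"] power_add)
       simp
  also have "\<dots> \<le> mean p / \<gamma> * p ^ (k - 2)"
    using mean_ge[of p] p \<gamma>_pos by (intro mult_right_mono) (auto simp: field_simps)
  also have "\<dots> \<le> mean p / \<gamma> * p ^ 1"
    using p k_ge_3 mean_pos[OF p(1)] \<gamma>_pos by (intro mult_left_mono power_decreasing) auto
  finally show "(card V * p ^ (k - 1))\<^sup>2 \<le> mean p * p / \<gamma>" by simp
qed

text \<open>In \<open>cond_mean_le\<close> the two middle terms carry a factor \<open>sqrt p\<close>
  for every factor \<open>ln (1 / p)\<close> that comes from \<open>card U\<close>. The logarithms
  are absorbed, and only constants depending on \<open>y\<close> remain.\<close>

lemma cond_mean_le_mean:
  fixes y :: real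
  assumes p: "0 < p" "p \<le> 1" and y: "0 \<le> y" and U: "U \<subseteq> V"
    and small: "card U \<le> y * (sqrt (mean p) * ln (1 / p))"
  shows "cond_mean p U \<le> (1 + 2 * y * D / sqrt \<gamma> + 4 * D * y\<^sup>2) * mean p + induced U"
proof -
  let ?L = "ln (1 / p)" and ?\<mu> = "mean p"
  have L: "0 \<le> ?L" using p by simp
  have \<mu>: "0 < ?\<mu>" using mean_pos p by simp
  have Lp: "?L * sqrt p \<le> 2" "0 \<le> ?L * sqrt p" using ln_inverse_mult_sqrt_le p L by auto
  have "card U * D * card V * p ^ (k - 1) = card U * D * (card V * p ^ (k - 1))" by simp
  also have "\<dots> \<le> y * (sqrt ?\<mu> * ?L) * D * sqrt (?\<mu> * p / \<gamma>)"
    using card_V_mult_power_le[OF p] small p \<mu> L y \<gamma>_pos by (intro mult_mono) (auto intro: mult_right_mono)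
  also have "\<dots> = y * D / sqrt \<gamma> * (?L * sqrt p) * ?\<mu>"
    using \<mu> by (simp add: real_sqrt_mult real_sqrt_divide)
  also have "\<dots> \<le> y * D / sqrt \<gamma> * 2 * ?\<mu>"
    using Lp \<mu> y \<gamma>_pos by (intro mult_right_mono mult_left_mono) auto
  finally have 1: "card U * D * card V * p ^ (k - 1) \<le> 2 * y * D / sqrt \<gamma> * ?\<mu>" by (simp add: mult_ac)
  have "D * (card U)\<^sup>2 * p \<le> D * (y * (sqrt ?\<mu> * ?L))\<^sup>2 * p"
    using small p by (intro mult_right_mono) (auto intro!: mult_left_mono power_mono)
  also have "\<dots> = D * y\<^sup>2 * (?L * sqrt p)\<^sup>2 * ?\<mu>"
    using \<mu> p by (simp add: power_mult_distrib)
  also have "\<dots> \<le> D * y\<^sup>2 * 2\<^sup>2 * ?\<mu>"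
    using Lp \<mu> by (intro mult_right_mono mult_left_mono power_mono) auto
  finally have 2: "D * (card U)\<^sup>2 * p \<le> 4 * D * y\<^sup>2 * ?\<mu>" by simp
  show ?thesis
    using cond_mean_le[OF U, of p] p 1 2 unfolding mean_def[symmetric] by (simp add: algebra_simps)
qed

text \<open>With \<open>q = 1 / (4 * k)\<close> the generator costs \<open>p powr (- m / 4)\<close>,
  and the rest of the core costs a power of the logarithm, at most another
  \<open>p powr (- m / 4)\<close>, both up to a constant per vertex. Against \<open>p ^ m\<close>
  this leaves \<open>p powr (m / 2)\<close>, half of which pays for the constants through
  \<open>small\<close>.\<close>

lemma card_cores_mult_power_le:
  fixes p d q B G :: real
  assumes p: "0 < p" and q: "q = 1 / (4 * k)" and d: "0 < d" "4 * k * D \<le> q ^ (2 * k - 1) * d"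
    and m: "0 < m" and B: "1 \<le> B" "card V / m \<le> B * p powr (- k / 2)"
    and G: "0 \<le> G" "2 * D * m / (q ^ (k - 1) * d * (ln (1 / p))\<^sup>2) \<le> G"
    and small: "64 * B * exp (1 + G) * p powr (1 / 4) \<le> 1"
  shows "card (cores d m) * p ^ m \<le> (p powr (1 / 4)) ^ m"
proof (cases "m \<le> card V")
  case False
  then have "cores d m = {}" unfolding cores_def using card_mono[OF finite_V] by fastforce
  then show ?thesis by simp
next
  case True
  let ?L = "ln (1 / p)"
  have k: "0 < real k" using k_ge_3 by simp
  have q': "0 < q" "q < 1" "2 * q \<le> 1" using k_ge_3 unfolding q by auto
  have "64 * 1 * 1 * p powr (1 / 4) \<le> 64 * B * exp (1 + G) * p powr (1 / 4)"
    using B G by (intro mult_right_mono mult_mono) auto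
  then have "p powr (1 / 4) \<le> 1 / 64" using small by simp
  then have "(p powr (1 / 4)) ^ 4 \<le> (1 / 64) ^ 4" by (intro power_mono) auto
  then have p64: "p \<le> 1 / 64" using p by (simp add: powr_power power_divide)
  have "exp 1 \<le> 1 / p"
  proof -
    have "64 \<le> 1 / p" using p64 p by (simp add: field_simps)
    then show ?thesis using exp_le by linarith
  qed
  then have L: "1 \<le> ?L" using p by (simp add: ln_ge_iff)
  define c where "c = 2 * D * (real m)\<^sup>2 / (q ^ (k - 1) * d)"
  \<comment> \<open>\<open>card_cores_le\<close> with \<open>z = m / card V\<close>, so that the
    first exponential is \<open>exp m\<close>, and \<open>x = 1 / ?L\<^sup>2\<close>, small enough
    for \<open>x * c\<close> to be at most \<open>G * m\<close>.\<close>
  have "card (cores d m) \<le> (1 / (m / card V)) powr (2 * q * m) * exp (m / card V * card V) * ((1 / (1 / ?L\<^sup>2)) ^ m * exp (1 / ?L\<^sup>2 * c))"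
  proof (rule card_cores_le[OF q'(1,2) d])
    show "0 < m / card V" "m / card V \<le> 1" using m True card_V_pos by auto
    show "0 < 1 / ?L\<^sup>2" "1 / ?L\<^sup>2 \<le> 1" using L by (auto simp: divide_le_eq)
    fix W assume W: "W \<subseteq> V" "card W \<le> 2 * q * m"
    have "card W \<le> real m" using W(2) q' mult_right_mono[OF q'(3), of "real m"] by simp
    have "q ^ (k - 1) / 2 * d * card (candidates (q ^ (k - 1) / 2 * d) W) \<le> D * (card W)\<^sup>2"
      using card_candidates_le W(1) finite_V finite_subset by blast
    also have "\<dots> \<le> D * (real m)\<^sup>2"
      using \<open>card W \<le> real m\<close> by (simp add: mult_left_mono)
    finally show "card (candidates (q ^ (k - 1) / 2 * d) W) \<le> c"
      using q' d by (simp add: c_def field_simps)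
  qed fact
  also have "\<dots> = (card V / m) powr (m / (2 * k)) * exp m * (?L\<^sup>2 ^ m * exp (1 / ?L\<^sup>2 * c))"
    using card_V_pos unfolding q by simp
  also have "\<dots> \<le> (B ^ m * p powr (- m / 4)) * exp m * ((64 * p powr (- 1 / 4)) ^ m * exp (G * m))"
  proof (intro mult_mono)
    have "(card V / m) powr (m / (2 * k)) \<le> (B * p powr (- k / 2)) powr (m / (2 * k))"
      using B by (intro powr_mono2) auto
    also have "\<dots> = B powr (m / (2 * k)) * p powr (- m / 4)"
      using B k p by (simp add: powr_mult powr_powr field_simps)
    also have "\<dots> \<le> B powr m * p powr (- m / 4)"
    proof (intro mult_right_mono powr_mono)
      have "real m * 1 \<le> real m * (2 * k)" using k_ge_3 by (intro mult_left_mono) auto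
      then show "m / (2 * k) \<le> real m" using k by (simp add: field_simps)
    qed (use B in auto)
    finally show "(card V / m) powr (m / (2 * k)) \<le> B ^ m * p powr (- m / 4)"
      using B by (simp add: powr_realpow)
    have "?L \<le> 8 * p powr (- 1 / 8)" using ln_inverse_le_powr[OF p, of "1 / 8"] by simp
    then have "?L\<^sup>2 \<le> (8 * p powr (- 1 / 8))\<^sup>2" using L by (intro power_mono) auto
    also have "\<dots> = 64 * p powr (- 1 / 4)"
      using p by (simp add: power_mult_distrib powr_power)
    finally show "?L\<^sup>2 ^ m \<le> (64 * p powr (- 1 / 4)) ^ m" by (intro power_mono) auto
    have "1 / ?L\<^sup>2 * c = 2 * D * m / (q ^ (k - 1) * d * ?L\<^sup>2) * m"
      by (simp add: c_def power2_eq_square mult_ac)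
    also have "\<dots> \<le> G * m" using G by (intro mult_right_mono) auto
    finally show "exp (1 / ?L\<^sup>2 * c) \<le> exp (G * m)" by simp
  qed (use B p in auto)
  also have "\<dots> = (B * p powr (- 1 / 4) * exp 1 * (64 * p powr (- 1 / 4) * exp G)) ^ m"
  proof -
    have "p powr (- m / 4) = (p powr (- 1 / 4)) ^ m" using p by (simp add: powr_power)
    moreover have "exp (real m) = exp 1 ^ m" by (simp flip: exp_of_nat_mult)
    moreover have "exp (G * m) = exp G ^ m" by (simp add: mult.commute flip: exp_of_nat_mult)
    ultimately show ?thesis by (simp only: power_mult_distrib)
  qed
  finally have "card (cores d m) * p ^ m
      \<le> (B * p powr (- 1 / 4) * exp 1 * (64 * p powr (- 1 / 4) * exp G)) ^ m * p ^ m"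
    using p by (intro mult_right_mono) auto
  also have "\<dots> = (64 * B * exp (1 + G) * (p powr (- 1 / 4) * p powr (- 1 / 4) * p)) ^ m"
    by (simp add: power_mult_distrib[symmetric] exp_add mult_ac)
  also have "p powr (- 1 / 4) * p powr (- 1 / 4) * p = p powr (1 / 4) * p powr (1 / 4)"
  proof -
    have "p powr (- 1 / 4) * p powr (- 1 / 4) * p powr 1 = p powr (1 / 4) * p powr (1 / 4)"
      unfolding powr_add[symmetric] by simp
    then show ?thesis using p by simp
  qed
  also have "(64 * B * exp (1 + G) * (p powr (1 / 4) * p powr (1 / 4))) ^ m \<le> (p powr (1 / 4)) ^ m"
  proof (rule power_mono)
    show "64 * B * exp (1 + G) * (p powr (1 / 4) * p powr (1 / 4)) \<le> p powr (1 / 4)"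
      using mult_right_mono[OF small, of "p powr (1 / 4)"] by (simp add: mult_ac)
  qed (use B in auto)
  finally show ?thesis .
qed

section \<open>Upper tail bounds for small \<open>p\<close> and for \<open>p\<close> bounded away
  from 0\<close>

definition rate :: "real \<Rightarrow> real" where
  "rate p = min (mean p) (sqrt (mean p) * ln (1 / p))"

lemma rate_nonneg: "0 < p \<Longrightarrow> p \<le> 1 \<Longrightarrow> 0 \<le> rate p"
  using mean_pos[of p] by (simp add: rate_def)

text \<open>The first term is the moment bound on the seedless event, the second the probability of
  a seed. Apart from \<open>p\<close>, the hypotheses involve only constants determined by
  \<open>\<epsilon>\<close>, \<open>\<gamma>\<close>, \<open>k\<close> and \<open>D\<close>, so the
  bound is uniform in the hypergraph.\<close>

lemma upper_tail_small_p:
  fixes p \<epsilon> y q B G :: real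
  assumes p: "0 < p" "p \<le> 1" and \<epsilon>: "0 < \<epsilon>"
    and y: "0 < y" "2 * y * D / sqrt \<gamma> + 4 * D * y\<^sup>2 \<le> \<epsilon> / 4"
    and q: "q = 1 / (4 * k)" "4 * k * D \<le> q ^ (2 * k - 1) * (\<epsilon> / (8 * y))"
    and B: "B = max 1 (sqrt (8 * D / (\<epsilon> * \<gamma>)))"
    and G: "G = 16 * D * y\<^sup>2 / (q ^ (k - 1) * \<epsilon>)"
    and small: "64 * B * exp (1 + G) * p powr (1 / 4) \<le> 1"
  shows "measure_pmf.prob (binomial_subset V p) {A. (1 + \<epsilon>) * mean p \<le> real (induced A)}
    \<le> ((1 + \<epsilon> / 2) / (1 + \<epsilon>)) ^ nat \<lfloor>y / k * rate p\<rfloor>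
      + 2 * exp (- (sqrt (\<epsilon> / (8 * D)) / 4) * (sqrt (mean p) * ln (1 / p)))"
proof -
  let ?L = "ln (1 / p)" and ?\<mu> = "mean p" and ?\<Phi> = "rate p"
  define l where "l = nat \<lfloor>y / k * rate p\<rfloor>"
  \<comment> \<open>Seeds have at most \<open>y * rate p\<close> vertices, so passing to a core of
    minimum degree \<open>d\<close> loses at most \<open>\<epsilon> * ?\<mu> / 8\<close> edges, half
    of \<open>M\<close>.\<close>
  define d where "d = \<epsilon> * ?\<mu> / (8 * y * ?\<Phi>)"
  \<comment> \<open>A seed has conditional mean above \<open>(1 + \<epsilon> / 2) * ?\<mu>\<close>,
    of which at most \<open>(1 + \<epsilon> / 4) * ?\<mu>\<close> does not come from induced
    edges.\<close>
  define M where "M = \<epsilon> * ?\<mu> / 4"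
  define r where "r = p powr (1 / 4)"
  have k: "0 < real k" using k_ge_3 by simp
  have q': "0 < q" using k unfolding q by simp
  have B1: "1 \<le> B" unfolding B by simp
  have G0: "0 \<le> G" unfolding G using q' \<epsilon> by simp
  have "64 * 1 * 1 * r \<le> 64 * B * exp (1 + G) * r"
    using B1 G0 unfolding r_def by (intro mult_right_mono mult_mono) auto
  then have r64: "r \<le> 1 / 64" using small unfolding r_def by simp
  have r0: "0 < r" using p unfolding r_def by simp
  have p1: "p < 1"
  proof (rule ccontr)
    assume "\<not> p < 1"
    then have "p = 1" using p by simp
    then show False using r64 unfolding r_def by simp
  qed
  have L: "0 < ?L" using p p1 by simp
  have \<mu>: "0 < ?\<mu>" using mean_pos p by simp
  have \<Phi>: "0 < ?\<Phi>" "?\<Phi> \<le> ?\<mu>" "?\<Phi> \<le> sqrt ?\<mu> * ?L" using \<mu> L by (auto simp: rate_def)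
  have "real l \<le> y / k * ?\<Phi>" unfolding l_def using y \<Phi> k by (simp add: floor_le_iff)
  then have b: "real (k * l) \<le> y * ?\<Phi>" using k by (simp add: field_simps)
  have d0: "0 < d" unfolding d_def using \<epsilon> \<mu> y \<Phi> by simp
  have M0: "0 < M" unfolding M_def using \<epsilon> \<mu> by simp
  have M2: "M / (2 * D) = \<epsilon> * ?\<mu> / (8 * D)" by (simp add: M_def)
  have "measure_pmf.prob (binomial_subset V p) {A. \<not> seedless p ((1 + \<epsilon> / 2) * ?\<mu>) (k * l) A}
      \<le> 2 * r powr sqrt (M / (2 * D))"
  proof (rule prob_seed_le)
    show "2 * d * real (k * l) \<le> M"
    proof -
      have "2 * d * real (k * l) \<le> 2 * d * (y * ?\<Phi>)" using b d0 by (intro mult_left_mono) auto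
      also have "\<dots> = M" unfolding d_def M_def using y \<Phi> by (simp add: field_simps)
      finally show ?thesis .
    qed
  next
    fix U assume U: "U \<subseteq> V" "card U \<le> k * l" "(1 + \<epsilon> / 2) * ?\<mu> < cond_mean p U"
    have "real (card U) \<le> y * ?\<Phi>" using U(2) b by (meson of_nat_le_iff order_trans)
    also have "\<dots> \<le> y * (sqrt ?\<mu> * ?L)" using \<Phi> y by (intro mult_left_mono) auto
    finally have "cond_mean p U \<le> (1 + 2 * y * D / sqrt \<gamma> + 4 * D * y\<^sup>2) * ?\<mu> + induced U"
      using cond_mean_le_mean[OF p _ U(1)] y by simp
    also have "\<dots> \<le> (1 + \<epsilon> / 4) * ?\<mu> + induced U"
      using y(2) \<mu> by (intro add_right_mono mult_right_mono) auto
    finally show "M \<le> induced U" using U(3) unfolding M_def by (simp add: algebra_simps)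
  next
    fix m assume m: "sqrt (M / (2 * D)) \<le> real m" "0 < m" "m \<le> k * l"
    show "card (cores d m) * p ^ m \<le> r ^ m"
      unfolding r_def
    proof (rule card_cores_mult_power_le[OF p(1) q(1) d0 _ m(2) B1 _ G0 _ small])
      have "\<epsilon> / (8 * y) \<le> d"
        unfolding d_def using \<Phi> \<epsilon> y by (simp add: field_simps)
      then have "q ^ (2 * k - 1) * (\<epsilon> / (8 * y)) \<le> q ^ (2 * k - 1) * d"
        using q' by (intro mult_left_mono) auto
      then show "4 * k * D \<le> q ^ (2 * k - 1) * d" using q(2) by linarith
      have pk: "p powr (- k / 2) * sqrt (p ^ k) = 1"
      proof -
        have "sqrt (p ^ k) = (p powr k) powr (1 / 2)"
          using p by (simp add: powr_half_sqrt powr_realpow)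
        also have "\<dots> = p powr (k / 2)" by (simp add: powr_powr)
        finally show ?thesis using p by (simp flip: powr_add)
      qed
      \<comment> \<open>Density bounds \<open>card V\<close> by
        \<open>p powr (- k / 2) * sqrt (?\<mu> / \<gamma>)\<close>, while \<open>m\<close> is at
        least of order \<open>sqrt ?\<mu>\<close>; \<open>B\<close> covers the ratio of the
        constants.\<close>
      have "real (card V) = p powr (- k / 2) * sqrt ((card V)\<^sup>2 * p ^ k)"
        using pk by (simp add: real_sqrt_mult mult_ac)
      also have "\<dots> \<le> p powr (- k / 2) * sqrt (?\<mu> / \<gamma>)"
        using mean_ge[of p] p \<gamma>_pos by (intro mult_left_mono real_sqrt_le_mono) (auto simp: field_simps)
      also have "?\<mu> / \<gamma> = (8 * D / (\<epsilon> * \<gamma>)) * (M / (2 * D))"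
        using D_pos \<epsilon> \<gamma>_pos unfolding M2 by (simp add: field_simps)
      also have "p powr (- k / 2) * sqrt ((8 * D / (\<epsilon> * \<gamma>)) * (M / (2 * D)))
          = p powr (- k / 2) * (sqrt (8 * D / (\<epsilon> * \<gamma>)) * sqrt (M / (2 * D)))"
        by (simp only: real_sqrt_mult)
      also have "\<dots> \<le> p powr (- k / 2) * (B * m)"
        using m(1) M0 B1 unfolding B by (intro mult_left_mono mult_mono) auto
      finally show "card V / m \<le> B * p powr (- k / 2)"
        using m(2) by (simp add: field_simps)
      \<comment> \<open>Here \<open>?\<Phi> \<le> sqrt ?\<mu> * ?L\<close> is needed:
        \<open>d\<close> is of order \<open>?\<mu> / ?\<Phi>\<close> and \<open>m\<close> at most
        \<open>y * ?\<Phi>\<close>, so \<open>m / (d * ?L\<^sup>2)\<close> is bounded by a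
        constant.\<close>
      have "real m \<le> y * ?\<Phi>" using m(3) b by (meson of_nat_le_iff order_trans)
      then have "real m * ?\<Phi> \<le> y * ?\<Phi> * ?\<Phi>" using \<Phi> by (intro mult_right_mono) auto
      also have "\<dots> = y * ?\<Phi>\<^sup>2" by (simp add: power2_eq_square)
      also have "\<dots> \<le> y * (sqrt ?\<mu> * ?L)\<^sup>2"
        using \<Phi> y by (intro mult_left_mono power_mono) auto
      also have "\<dots> = y * ?\<mu> * ?L\<^sup>2" using \<mu> by (simp add: power_mult_distrib)
      finally have key: "real m * ?\<Phi> \<le> y * ?\<mu> * ?L\<^sup>2" .
      have "2 * D * m / (q ^ (k - 1) * d * ?L\<^sup>2) = (16 * D * y / (q ^ (k - 1) * \<epsilon>)) * (m * ?\<Phi> / (?\<mu> * ?L\<^sup>2))"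
        using \<Phi> \<epsilon> y \<mu> L q' unfolding d_def by (simp add: field_simps)
      also have "\<dots> \<le> (16 * D * y / (q ^ (k - 1) * \<epsilon>)) * y"
        using key \<mu> L q' \<epsilon> y by (intro mult_left_mono) (auto simp: field_simps)
      finally show "2 * D * m / (q ^ (k - 1) * d * ?L\<^sup>2) \<le> G"
        unfolding G by (simp add: power2_eq_square mult_ac)
    qed
  qed (use p d0 M0 r0 r64 in auto)
  moreover have "r powr sqrt (M / (2 * D)) = exp (- (sqrt (\<epsilon> / (8 * D)) / 4) * (sqrt ?\<mu> * ?L))"
    unfolding M2 using p by (simp add: r_def powr_powr powr_def ln_div real_sqrt_mult real_sqrt_divide)
  moreover have "((1 + \<epsilon> / 2) * ?\<mu> / ((1 + \<epsilon>) * ?\<mu>)) = (1 + \<epsilon> / 2) / (1 + \<epsilon>)"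
    using \<mu> by simp
  ultimately show ?thesis
    using upper_tail_le_seed[OF _ p(2), of "(1 + \<epsilon> / 2) * ?\<mu>" "(1 + \<epsilon>) * ?\<mu>" l] \<mu> \<epsilon> p
    unfolding l_def by simp
qed

text \<open>For \<open>p \<ge> p0\<close> the rate is at most linear in \<open>card V\<close>,
  whereas the mean is quadratic. A set of \<open>y * rate p\<close> vertices with small
  \<open>y\<close> therefore meets too few edges to be a seed, and only the moment bound is
  left.\<close>

lemma upper_tail_large_p:
  fixes p p0 \<epsilon> y :: real
  assumes p: "0 < p0" "p0 \<le> p" "p \<le> 1" and \<epsilon>: "0 < \<epsilon>"
    and y: "0 < y" "y * (sqrt D * ln (1 / p0)) * D \<le> \<epsilon> / 2 * \<gamma> * p0 ^ k"
  shows "measure_pmf.prob (binomial_subset V p) {A. (1 + \<epsilon>) * mean p \<le> real (induced A)}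
    \<le> ((1 + \<epsilon> / 2) / (1 + \<epsilon>)) ^ nat \<lfloor>y / k * rate p\<rfloor>"
proof -
  let ?L = "ln (1 / p)" and ?\<mu> = "mean p" and ?\<Phi> = "rate p" and ?R = "binomial_subset V p"
  define l where "l = nat \<lfloor>y / k * rate p\<rfloor>"
  have k: "0 < real k" using k_ge_3 by simp
  have p': "0 < p" using p by linarith
  have \<mu>: "0 < ?\<mu>" using mean_pos p' by simp
  have \<Phi>0: "0 \<le> ?\<Phi>" using rate_nonneg p' p(3) by simp
  have "?\<mu> \<le> real (card H) * 1"
    unfolding mean_def using p' p(3) by (intro mult_left_mono power_le_one) auto
  also have "\<dots> \<le> D * (card V)\<^sup>2" using card_H_le by (simp flip: of_nat_mult of_nat_power)
  finally have "sqrt ?\<mu> \<le> sqrt (D * (card V)\<^sup>2)" by simp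
  then have "sqrt ?\<mu> \<le> sqrt D * card V" by (simp add: real_sqrt_mult)
  moreover have "?L \<le> ln (1 / p0)" "0 \<le> ?L" using p p' by (auto simp: field_simps)
  ultimately have "sqrt ?\<mu> * ?L \<le> sqrt D * card V * ln (1 / p0)" by (intro mult_mono) auto
  then have \<Phi>: "?\<Phi> \<le> sqrt D * card V * ln (1 / p0)" unfolding rate_def by linarith
  have "real l \<le> y / k * ?\<Phi>" unfolding l_def using y \<Phi>0 k by (simp add: floor_le_iff)
  then have b: "real (k * l) \<le> y * ?\<Phi>" using k by (simp add: field_simps)
  have "measure_pmf.prob ?R {A. \<not> seedless p ((1 + \<epsilon> / 2) * ?\<mu>) (k * l) A}
      = measure_pmf.prob ?R ({A. \<not> seedless p ((1 + \<epsilon> / 2) * ?\<mu>) (k * l) A} \<inter> set_pmf ?R)"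
    by (rule measure_Int_set_pmf[symmetric])
  also have "{A. \<not> seedless p ((1 + \<epsilon> / 2) * ?\<mu>) (k * l) A} \<inter> set_pmf ?R = {}"
  proof -
    have "cond_mean p U \<le> (1 + \<epsilon> / 2) * ?\<mu>" if U: "U \<subseteq> V" "card U \<le> k * l" for U
    proof -
      have "real (card U) \<le> y * ?\<Phi>" using U(2) b by (meson of_nat_le_iff order_trans)
      also have "\<dots> \<le> y * (sqrt D * card V * ln (1 / p0))" using \<Phi> y by (intro mult_left_mono) auto
      finally have "card U * (D * card V) \<le> y * (sqrt D * card V * ln (1 / p0)) * (D * card V)"
        by (simp add: mult_right_mono)
      also have "\<dots> = y * (sqrt D * ln (1 / p0)) * D * (card V)\<^sup>2" by (simp add: power2_eq_square)
      also have "\<dots> \<le> \<epsilon> / 2 * \<gamma> * p0 ^ k * (card V)\<^sup>2" using y(2) by (intro mult_right_mono) auto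
      also have "\<dots> \<le> \<epsilon> / 2 * \<gamma> * p ^ k * (card V)\<^sup>2"
        using p \<epsilon> \<gamma>_pos by (intro mult_right_mono mult_left_mono power_mono) auto
      also have "\<dots> \<le> \<epsilon> / 2 * ?\<mu>" using mean_ge[of p] p' \<epsilon> by (simp add: mult_ac)
      finally have "card U * (D * card V) \<le> \<epsilon> / 2 * ?\<mu>" .
      then show ?thesis
        using cond_mean_le_trivial[OF U(1), of p] p' p(3) by (simp add: mean_def algebra_simps)
    qed
    then show ?thesis
      using set_binomial_subset[of V p] unfolding seedless_def by blast
  qed
  finally have "measure_pmf.prob ?R {A. \<not> seedless p ((1 + \<epsilon> / 2) * ?\<mu>) (k * l) A} = 0" by simp
  moreover have "((1 + \<epsilon> / 2) * ?\<mu> / ((1 + \<epsilon>) * ?\<mu>)) = (1 + \<epsilon> / 2) / (1 + \<epsilon>)"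
    using \<mu> by simp
  ultimately show ?thesis
    using upper_tail_le_seed[OF _ p(3), of "(1 + \<epsilon> / 2) * ?\<mu>" "(1 + \<epsilon>) * ?\<mu>" l] \<mu> \<epsilon> p'
    unfolding l_def by simp
qed

text \<open>Serves the case of a small rate, where a bound \<open>K * exp (- b * rate p)\<close>
  with \<open>K > 1\<close> may exceed 1.\<close>

lemma upper_tail_Markov:
  fixes p \<epsilon> :: real
  assumes p: "0 < p" "p \<le> 1" and \<epsilon>: "0 < \<epsilon>"
  shows "measure_pmf.prob (binomial_subset V p) {A. (1 + \<epsilon>) * mean p \<le> real (induced A)} \<le> 1 / (1 + \<epsilon>)"
proof -
  let ?R = "binomial_subset V p"
  have "(1 + \<epsilon>) * mean p * measure_pmf.prob ?R {A. (1 + \<epsilon>) * mean p \<le> real (induced A)}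
      = measure_pmf.expectation ?R (\<lambda>A. (1 + \<epsilon>) * mean p * of_bool ((1 + \<epsilon>) * mean p \<le> real (induced A)))"
    by (simp only: integral_mult_right_zero expectation_of_bool)
  also have "\<dots> \<le> measure_pmf.expectation ?R (\<lambda>A. real (induced A))"
    by (rule integral_mono) (use finite_V in auto)
  also have "\<dots> = mean p" using expectation_induced p by (simp add: mean_def)
  finally have "mean p * ((1 + \<epsilon>) * measure_pmf.prob ?R {A. (1 + \<epsilon>) * mean p \<le> real (induced A)}) \<le> mean p * 1"
    by (simp add: mult_ac)
  then have "(1 + \<epsilon>) * measure_pmf.prob ?R {A. (1 + \<epsilon>) * mean p \<le> real (induced A)} \<le> 1"
    using mean_pos[OF p(1)] by (simp only: mult_le_cancel_left_pos)
  then show ?thesis using \<epsilon> by (simp add: pos_le_divide_eq mult.commute)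
qed

end

section \<open>Removing prefactors; an upper tail constant uniform over all hypergraphs\<close>

text \<open>The weighted geometric mean of the two bounds, with weights proportional to
  \<open>a\<close> and \<open>ln K\<close> so that \<open>K\<close> cancels.\<close>

lemma le_exp_interpolation:
  fixes P K a b \<Phi> :: real
  assumes "P \<le> K * exp (- b * \<Phi>)" "P \<le> exp (- a)" "1 \<le> K" "0 < a"
  shows "P \<le> exp (- (a * b / (ln K + a)) * \<Phi>)"
proof (cases "0 < P")
  case True
  have K: "0 \<le> ln K" using assms by simp
  have "ln P \<le> ln (K * exp (- b * \<Phi>))" using assms True by (subst ln_le_cancel_iff) auto
  also have "\<dots> = ln K - b * \<Phi>" using assms by (simp add: ln_mult)
  finally have 1: "a * ln P \<le> a * (ln K - b * \<Phi>)" using assms by (intro mult_left_mono) auto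
  have "ln P \<le> ln (exp (- a))" using assms True by (subst ln_le_cancel_iff) auto
  then have 2: "ln K * ln P \<le> ln K * (- a)" using K by (intro mult_left_mono) auto
  have "ln P * (ln K + a) \<le> - (a * b) * \<Phi>" using 1 2 by (simp add: algebra_simps)
  moreover have "0 < ln K + a" using K assms(4) by (rule add_nonneg_pos)
  ultimately have "ln P \<le> - (a * b) * \<Phi> / (ln K + a)" by (simp only: pos_le_divide_eq)
  then have "ln P \<le> - (a * b / (ln K + a)) * \<Phi>" by simp
  then show ?thesis using True by (metis exp_le_cancel_iff exp_ln)
next
  case False
  then show ?thesis by (meson exp_ge_zero linorder_not_le order_trans)
qed

text \<open>Rounding the exponent down costs at most one factor \<open>1 / \<rho>\<close>.\<close>

lemma power_floor_le_exp:
  fixes \<rho> x :: real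
  assumes "0 < \<rho>" "\<rho> < 1" "0 \<le> x"
  shows "\<rho> ^ nat \<lfloor>x\<rfloor> \<le> 1 / \<rho> * exp (- ln (1 / \<rho>) * x)"
proof -
  have "\<rho> ^ nat \<lfloor>x\<rfloor> = \<rho> powr real (nat \<lfloor>x\<rfloor>)" using assms(1) by (rule powr_realpow[symmetric])
  also have "\<dots> \<le> \<rho> powr (x - 1)" using assms by (intro powr_mono') linarith+
  also have "\<dots> = 1 / \<rho> * exp (- ln (1 / \<rho>) * x)"
    using assms by (simp add: powr_def ln_div right_diff_distrib exp_diff mult.commute)
  finally show ?thesis .
qed

text \<open>The order of choices avoids circularity: \<open>y1\<close> determines \<open>G\<close>
  and with it the threshold \<open>p0\<close> between small and large \<open>p\<close>, and only
  then is \<open>y2\<close> chosen for \<open>p \<ge> p0\<close>. The two resulting bounds are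
  merged with Markov's inequality to remove the prefactor.\<close>

lemma upper_tail_constant_exists:
  fixes \<epsilon> \<gamma> :: real and k D :: nat
  assumes \<epsilon>: "0 < \<epsilon>" and \<gamma>: "0 < \<gamma>" and D: "0 < D" and k: "3 \<le> k"
  obtains c where "0 < c" "\<And>V H p. dense_hypergraph V H k D \<gamma> \<Longrightarrow> 0 < p \<Longrightarrow> p \<le> 1 \<Longrightarrow>
    measure_pmf.prob (binomial_subset V p)
      {A. (1 + \<epsilon>) * dense_hypergraph.mean H k p \<le> real (codegree_hypergraph.induced H A)}
    \<le> exp (- c * dense_hypergraph.rate H k p)"
proof -
  define q where "q = 1 / (4 * real k)"
  define E where "E = 2 * D / sqrt \<gamma> + 4 * D"
  \<comment> \<open>The bound 1 gives \<open>y1\<^sup>2 \<le> y1\<close>, the second term keeps the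
    excess in \<open>cond_mean_le_mean\<close> below \<open>\<epsilon> / 4\<close>, and the third
    ensures the degree condition for cores.\<close>
  define y1 where "y1 = min 1 (min (\<epsilon> / (4 * E)) (q ^ (2 * k - 1) * \<epsilon> / (32 * k * D)))"
  define B where "B = max 1 (sqrt (8 * D / (\<epsilon> * \<gamma>)))"
  define G where "G = 16 * D * y1\<^sup>2 / (q ^ (k - 1) * \<epsilon>)"
  \<comment> \<open>The value of \<open>p\<close> at which the condition \<open>small\<close> of
    \<open>upper_tail_small_p\<close> is an equality.\<close>
  define p0 where "p0 = (1 / (64 * B * exp (1 + G))) ^ 4"
  \<comment> \<open>Solves the condition on \<open>y\<close> in \<open>upper_tail_large_p\<close>
    with equality.\<close>
  define y2 where "y2 = \<epsilon> / 2 * \<gamma> * p0 ^ k / (sqrt D * ln (1 / p0) * D)"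
  define \<rho> where "\<rho> = (1 + \<epsilon> / 2) / (1 + \<epsilon>)"
  define \<kappa> where "\<kappa> = sqrt (\<epsilon> / (8 * D)) / 4"
  define c1 where "c1 = min (min (ln (1 / \<rho>) * (y1 / k)) (ln (1 / \<rho>) * (y2 / k))) \<kappa>"
  \<comment> \<open>\<open>1 / \<rho>\<close> comes from rounding the exponent, 2 from the geometric
    series over core sizes.\<close>
  define K where "K = 1 / \<rho> + 2"
  have k0: "0 < real k" and D0: "0 < real D" using k D by auto
  have q: "0 < q" using k0 by (simp add: q_def)
  have E: "0 < E" unfolding E_def using D0 \<gamma> by (simp add: add_pos_pos)
  have y1: "0 < y1" "y1 \<le> 1" "y1 \<le> \<epsilon> / (4 * E)"
      "y1 \<le> q ^ (2 * k - 1) * \<epsilon> / (32 * k * D)"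
    using q \<epsilon> E k0 D0 by (auto simp: y1_def)
  have B: "1 \<le> B" by (simp add: B_def)
  have G: "0 \<le> G" using q \<epsilon> by (simp add: G_def)
  have "64 * 1 * 1 \<le> 64 * B * exp (1 + G)" using B G by (intro mult_mono) auto
  then have den: "64 \<le> 64 * B * exp (1 + G)" by simp
  then have p0: "0 < p0" "p0 < 1"
    using power_strict_mono[of "1 / (64 * B * exp (1 + G))" 1 4] by (auto simp: p0_def)
  have lnp0: "0 < ln (1 / p0)" using p0 by simp
  have y2: "0 < y2" using \<epsilon> \<gamma> p0 lnp0 D0 by (simp add: y2_def)
  have \<rho>: "0 < \<rho>" "\<rho> < 1" using \<epsilon> by (auto simp: \<rho>_def field_simps)
  have ln\<rho>: "0 < ln (1 / \<rho>)" using \<rho> by simp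
  have \<kappa>: "0 < \<kappa>" using \<epsilon> D0 by (simp add: \<kappa>_def)
  have c1: "0 < c1" using ln\<rho> y1 y2 k0 \<kappa> by (simp add: c1_def)
  have K: "1 \<le> K" using \<rho> by (simp add: K_def)
  define a where "a = ln (1 + \<epsilon>)"
  have a: "0 < a" using \<epsilon> by (simp add: a_def)
  show thesis
  proof (rule that)
    show "0 < a * c1 / (ln K + a)" using a c1 K by (simp add: add_nonneg_pos)
    fix V :: "'a set" and H and p :: real
    assume "dense_hypergraph V H k D \<gamma>" and p: "0 < p" "p \<le> 1"
    then interpret dense_hypergraph V H k D \<gamma> by simp
    let ?P = "measure_pmf.prob (binomial_subset V p) {A. (1 + \<epsilon>) * mean p \<le> real (induced A)}"
    have \<Phi>: "0 \<le> rate p" using rate_nonneg p by simp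
    have decay: "\<rho> ^ nat \<lfloor>y / k * rate p\<rfloor> \<le> 1 / \<rho> * exp (- c1 * rate p)"
      if "0 < y" "c1 \<le> ln (1 / \<rho>) * (y / k)" for y
    proof -
      have "\<rho> ^ nat \<lfloor>y / k * rate p\<rfloor> \<le> 1 / \<rho> * exp (- ln (1 / \<rho>) * (y / k * rate p))"
        using that \<rho> \<Phi> k0 by (intro power_floor_le_exp) auto
      also have "\<dots> \<le> 1 / \<rho> * exp (- c1 * rate p)"
        using mult_right_mono[OF that(2) \<Phi>] \<rho> by (intro mult_left_mono) (auto simp: mult.assoc)
      finally show ?thesis .
    qed
    have "?P \<le> K * exp (- c1 * rate p)"
    proof (cases "p \<le> p0")
      case True
      have "y1\<^sup>2 \<le> y1" using y1(1,2) by (simp add: power2_eq_square mult_left_le)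
      then have "2 * y1 * D / sqrt \<gamma> + 4 * D * y1\<^sup>2 \<le> 2 * y1 * D / sqrt \<gamma> + 4 * D * y1"
        by (intro add_left_mono mult_left_mono) auto
      also have "\<dots> = y1 * E" by (simp add: E_def algebra_simps)
      also have "\<dots> \<le> \<epsilon> / 4" using y1(3) E by (simp add: field_simps)
      finally have 1: "2 * y1 * D / sqrt \<gamma> + 4 * D * y1\<^sup>2 \<le> \<epsilon> / 4" .
      have 2: "4 * k * D \<le> q ^ (2 * k - 1) * (\<epsilon> / (8 * y1))"
      proof -
        have "4 * X \<le> Q * (e / (8 * y))" if "0 < y" "0 < X" "y \<le> Q * e / (32 * X)" for X Q e y :: real
          using that by (simp add: field_simps)
        from this[of y1 "k * D" "q ^ (2 * k - 1)" \<epsilon>] show ?thesis using y1(1,4) k0 D0 by (simp add: mult.assoc)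
      qed
      have "p powr (1 / 4) \<le> p0 powr (1 / 4)" using True p by (intro powr_mono2) auto
      also have "\<dots> = 1 / (64 * B * exp (1 + G))"
      proof -
        have pos: "0 < 1 / (64 * B * exp (1 + G))" using den by simp
        then have "p0 = (1 / (64 * B * exp (1 + G))) powr 4"
          unfolding p0_def using powr_realpow[OF pos, of 4] by simp
        then show ?thesis using pos by (simp only: powr_powr) simp
      qed
      finally have 3: "64 * B * exp (1 + G) * p powr (1 / 4) \<le> 1"
        using den by (simp add: field_simps)
      have "?P \<le> \<rho> ^ nat \<lfloor>y1 / k * rate p\<rfloor> + 2 * exp (- \<kappa> * (sqrt (mean p) * ln (1 / p)))"
        unfolding \<rho>_def \<kappa>_def
        by (rule upper_tail_small_p[where y = y1 and q = q and B = B and G = G, OF p \<epsilon> y1(1)])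
           (use 1 q_def 2 B_def G_def 3 in \<open>simp_all only: of_nat_mult of_nat_numeral\<close>)
      also have "\<dots> \<le> 1 / \<rho> * exp (- c1 * rate p) + 2 * exp (- c1 * rate p)"
      proof (intro add_mono decay mult_left_mono)
        have "c1 * rate p \<le> \<kappa> * rate p" using \<Phi> by (intro mult_right_mono) (auto simp: c1_def)
        also have "\<dots> \<le> \<kappa> * (sqrt (mean p) * ln (1 / p))"
          using \<kappa> by (intro mult_left_mono) (auto simp: rate_def)
        finally show "exp (- \<kappa> * (sqrt (mean p) * ln (1 / p))) \<le> exp (- c1 * rate p)" by simp
      qed (use y1 c1_def in auto)
      finally show ?thesis by (simp add: K_def algebra_simps)
    next
      case False
      have "?P \<le> \<rho> ^ nat \<lfloor>y2 / k * rate p\<rfloor>"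
        unfolding \<rho>_def
        by (rule upper_tail_large_p[OF p0(1) _ p(2) \<epsilon> y2])
           (use False y2_def lnp0 D0 in \<open>auto simp: field_simps\<close>)
      also have "\<dots> \<le> 1 / \<rho> * exp (- c1 * rate p)"
        by (rule decay[OF y2]) (simp add: c1_def)
      also have "\<dots> \<le> K * exp (- c1 * rate p)" by (intro mult_right_mono) (auto simp: K_def)
      finally show ?thesis .
    qed
    moreover have "?P \<le> exp (- a)"
      using upper_tail_Markov[OF p \<epsilon>] \<epsilon> by (simp add: a_def exp_minus inverse_eq_divide)
    ultimately show "?P \<le> exp (- (a * c1 / (ln K + a)) * rate p)"
      using K a by (intro le_exp_interpolation) auto
  qed
qed

section \<open>Lower tail when the mean is at most the squared logarithm\<close>

text \<open>Bounding the logarithm by a power with exponent \<open>1 / 16\<close> makes its fourth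
  power at most of order \<open>(n\<^sup>2) powr (1 / 4) = sqrt n\<close>.\<close>

lemma eventually_ln_power4_le:
  fixes a b c :: real
  assumes "0 < a" "0 < b" "0 < c"
  shows "eventually (\<lambda>n::nat. b * ln (a * n\<^sup>2) ^ 4 \<le> c * n) sequentially"
proof -
  define K where "K = b * (16 ^ 4 * a powr (1 / 4))"
  have "eventually (\<lambda>n::nat. 1 \<le> a * n\<^sup>2) sequentially" using assms(1) by real_asymp
  moreover have "eventually (\<lambda>n::nat. K * sqrt n \<le> c * n) sequentially" using assms(3) by real_asymp
  ultimately show ?thesis
  proof eventually_elim
    case (elim n)
    define X where "X = a * (real n)\<^sup>2"
    have X: "1 \<le> X" using elim(1) by (simp add: X_def)
    have n: "0 < real n" using X by (cases "n = 0") (auto simp: X_def)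
    have "ln X \<le> 16 * X powr (1 / 16)"
      using ln_powr_bound[OF X, of "1 / 16"] by simp
    then have "ln X ^ 4 \<le> (16 * X powr (1 / 16)) ^ 4" using X by (intro power_mono) auto
    also have "\<dots> = 16 ^ 4 * (X powr (1 / 16)) ^ 4" by (rule power_mult_distrib)
    also have "(X powr (1 / 16)) ^ 4 = X powr (1 / 4)" using X by (simp add: powr_power)
    also have "X powr (1 / 4) = a powr (1 / 4) * (real n powr 2) powr (1 / 4)"
      using assms(1) n by (simp add: X_def powr_mult)
    also have "(real n powr 2) powr (1 / 4) = sqrt n"
      unfolding powr_powr using n by (simp add: powr_half_sqrt)
    finally have "b * ln X ^ 4 \<le> b * (16 ^ 4 * (a powr (1 / 4) * sqrt n))"
      using assms(2) by (intro mult_left_mono) auto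
    then have "b * ln (a * (real n)\<^sup>2) ^ 4 \<le> K * sqrt n"
      unfolding K_def X_def by (simp only: mult.assoc)
    then show ?case using elim(2) by simp
  qed
qed

text \<open>If \<open>sqrt \<mu> \<le> ln (1 / p)\<close>, then
  \<open>\<mu> \<le> sqrt \<mu> * ln (1 / p)\<close>, so the union of a packing is small enough for
  \<open>cond_mean_le_mean\<close> and \<open>G\<close> can be a constant multiple of
  \<open>\<mu>\<close>. Moreover \<open>\<mu>\<close> is then polylogarithmic in
  \<open>card V\<close>, which leaves room for the packings once \<open>card V\<close> is
  large.\<close>

lemma lower_tail_small_mean_constant_exists:
  fixes \<epsilon> \<gamma> :: real and k D :: nat
  assumes \<epsilon>: "0 < \<epsilon>" and \<gamma>: "0 < \<gamma>" and D: "0 < D" and k: "3 \<le> k"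
  obtains C :: real and n0 :: nat where "0 < C" "\<And>V H p. dense_hypergraph V H k D \<gamma> \<Longrightarrow> n0 \<le> card V \<Longrightarrow> 0 < p \<Longrightarrow> p \<le> 1 \<Longrightarrow>
    1 \<le> (1 + \<epsilon>) * dense_hypergraph.mean H k p \<Longrightarrow>
    sqrt (dense_hypergraph.mean H k p) \<le> ln (1 / p) \<Longrightarrow>
    exp (- C * dense_hypergraph.mean H k p) \<le> measure_pmf.prob (binomial_subset V p)
      {A. (1 + \<epsilon>) * dense_hypergraph.mean H k p \<le> real (codegree_hypergraph.induced H A)}"
proof -
  \<comment> \<open>Rounding \<open>(1 + \<epsilon>) * \<mu> \<ge> 1\<close> up to \<open>r\<close>
    at most doubles it, so \<open>r \<le> h * \<mu>\<close>.\<close>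
  define h where "h = 2 * (1 + \<epsilon>)"
  define y where "y = k * h"
  \<comment> \<open>The factor from \<open>cond_mean_le_mean\<close> with this \<open>y\<close>,
    plus the edges induced by the union of a packing, both relative to the mean.\<close>
  define g where "g = 1 + 2 * y * D / sqrt \<gamma> + 4 * D * y\<^sup>2 + h * (D * k\<^sup>2)"
  \<comment> \<open>Chosen so that \<open>room\<close> follows from
    \<open>E * \<mu>\<^sup>2 \<le> \<gamma> * card V\<close>; here \<open>\<mu>\<^sup>2\<close> is
    at most the fourth power of the logarithm.\<close>
  define E where "E = 2 * (k + D * k ^ 3) * D * h\<^sup>2"
  have k0: "0 < real k" and D0: "0 < real D" using k D by auto
  have h: "0 < h" using \<epsilon> by (simp add: h_def)
  have y: "0 < y" using h k0 by (simp add: y_def)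
  have g: "1 \<le> g" using y h \<gamma> by (simp add: g_def)
  have "eventually (\<lambda>n::nat. E * ln ((1 + \<epsilon>) * D * (real n)\<^sup>2) ^ 4 \<le> \<gamma> * real n) sequentially"
    using \<epsilon> D0 \<gamma> k0 h by (intro eventually_ln_power4_le) (auto simp: E_def intro!: mult_pos_pos add_pos_nonneg)
  then obtain n0 where n0: "\<forall>n\<ge>n0. E * ln ((1 + \<epsilon>) * D * (real n)\<^sup>2) ^ 4 \<le> \<gamma> * real n"
    unfolding eventually_sequentially by (elim exE)
  show thesis
  proof (rule that)
    show "0 < ln (2 * g) * h" using g h by simp
    fix V :: "'a set" and H and p :: real
    assume "dense_hypergraph V H k D \<gamma>" and n: "n0 \<le> card V" and p: "0 < p" "p \<le> 1"
      and large: "1 \<le> (1 + \<epsilon>) * dense_hypergraph.mean H k p"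
      and small: "sqrt (dense_hypergraph.mean H k p) \<le> ln (1 / p)"
    then interpret dense_hypergraph V H k D \<gamma> by simp
    let ?\<mu> = "mean p" and ?L = "ln (1 / p)"
    define r where "r = nat \<lceil>(1 + \<epsilon>) * ?\<mu>\<rceil>"
    have \<mu>: "0 < ?\<mu>" using mean_pos p by simp
    have L: "0 \<le> ?L" using p by simp
    have "real r \<le> (1 + \<epsilon>) * ?\<mu> + 1" unfolding r_def using large by linarith
    then have r: "real r \<le> h * ?\<mu>" using large unfolding h_def by linarith
    have "sqrt ?\<mu> * sqrt ?\<mu> \<le> sqrt ?\<mu> * ?L" using small \<mu> by (intro mult_left_mono) auto
    then have \<mu>L: "?\<mu> \<le> sqrt ?\<mu> * ?L" using \<mu> by simp
    also have "\<dots> \<le> ?L * ?L" using small L by (intro mult_right_mono) auto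
    finally have \<mu>L2: "?\<mu> \<le> ?L\<^sup>2" by (simp add: power2_eq_square)
    \<comment> \<open>A mean of at least \<open>1 / (1 + \<epsilon>)\<close> keeps \<open>p\<close>
      above a negative power of \<open>card V\<close>, up to constants, which bounds
      \<open>ln (1 / p)\<close> by a logarithm of \<open>card V\<close>.\<close>
    have "1 \<le> (1 + \<epsilon>) * D * (card V)\<^sup>2 * p ^ k"
    proof -
      have "?\<mu> \<le> (D * (card V)\<^sup>2) * p ^ k"
        unfolding mean_def using card_H_le p by (intro mult_right_mono) (auto simp flip: of_nat_mult of_nat_power)
      then have "(1 + \<epsilon>) * ?\<mu> \<le> (1 + \<epsilon>) * ((D * (card V)\<^sup>2) * p ^ k)"
        using \<epsilon> by (intro mult_left_mono) auto
      then show ?thesis using large by (simp add: mult_ac)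
    qed
    then have "(1 / p) ^ k \<le> (1 + \<epsilon>) * D * (card V)\<^sup>2"
      using p by (simp add: power_divide field_simps)
    then have "ln ((1 / p) ^ k) \<le> ln ((1 + \<epsilon>) * D * (real (card V))\<^sup>2)"
      using p \<epsilon> D0 card_V_pos by (subst ln_le_cancel_iff) auto
    then have "k * ?L \<le> ln ((1 + \<epsilon>) * D * (real (card V))\<^sup>2)"
      using p by (simp add: ln_realpow)
    moreover have "1 * ?L \<le> k * ?L" using k L by (intro mult_right_mono) auto
    ultimately have L_le: "?L \<le> ln ((1 + \<epsilon>) * D * (real (card V))\<^sup>2)" by simp
    have r1: "1 \<le> real r" unfolding r_def using large by linarith
    let ?N = "real (2 * (k * r + D * (k * r)\<^sup>2 * k) * D)"
    have "?N \<le> E * ?\<mu>\<^sup>2"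
    proof -
      have "?N = 2 * (k * real r + D * (k * real r)\<^sup>2 * k) * D" by simp
      also have "\<dots> \<le> 2 * (k * (real r)\<^sup>2 + D * (k * real r)\<^sup>2 * k) * D"
        using r1 by (intro mult_right_mono mult_left_mono add_right_mono) (auto simp: power2_eq_square)
      also have "\<dots> = 2 * (k + D * k ^ 3) * D * (real r)\<^sup>2"
        by (simp add: algebra_simps power2_eq_square power3_eq_cube)
      also have "\<dots> \<le> 2 * (k + D * k ^ 3) * D * (h * ?\<mu>)\<^sup>2"
        using r by (intro mult_left_mono power_mono) auto
      finally show ?thesis by (simp add: E_def power_mult_distrib mult_ac)
    qed
    also have "\<dots> \<le> E * (?L\<^sup>2)\<^sup>2"
      using \<mu>L2 \<mu> h by (intro mult_left_mono power_mono) (auto simp: E_def)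
    also have "\<dots> = E * ?L ^ 4" by simp
    also have "\<dots> \<le> E * ln ((1 + \<epsilon>) * D * (real (card V))\<^sup>2) ^ 4"
      using L_le L h by (intro mult_left_mono power_mono) (auto simp: E_def)
    also have "\<dots> \<le> \<gamma> * real (card V)" by (rule n0[rule_format, OF n])
    finally have "?N * card V \<le> \<gamma> * real (card V) * card V"
      by (intro mult_right_mono) auto
    also have "\<dots> \<le> card H" using dense by (simp add: power2_eq_square mult_ac)
    finally have room: "2 * ((k * r + D * (k * r)\<^sup>2 * k) * D * card V) \<le> card H"
      by (simp only: mult.assoc of_nat_le_iff flip: of_nat_mult)
    have H: "H \<noteq> {}" using card_H_pos by auto
    have "(card H * p ^ k / (2 * (g * ?\<mu>))) ^ r \<le> measure_pmf.prob (binomial_subset V p) {A. r \<le> induced A}"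
    proof (rule prob_many_edges_ge[OF p H room])
      show "0 < g * ?\<mu>" using g \<mu> by simp
      fix U assume U: "U \<subseteq> V" "card U = k * r" "induced U \<le> r * (D * k\<^sup>2)"
      have "real (card U) = k * real r" using U(2) by simp
      also have "\<dots> \<le> k * (h * (sqrt ?\<mu> * ?L))"
        using r \<mu>L h by (intro mult_left_mono) (auto intro: order_trans mult_left_mono)
      finally have "real (card U) \<le> y * (sqrt ?\<mu> * ?L)" by (simp add: y_def mult.assoc)
      then have "cond_mean p U \<le> (1 + 2 * y * D / sqrt \<gamma> + 4 * D * y\<^sup>2) * ?\<mu> + induced U"
        using cond_mean_le_mean[OF p _ U(1)] y by simp
      also have "real (induced U) \<le> real r * (D * k\<^sup>2)"
        using U(3) by (simp flip: of_nat_mult of_nat_power)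
      also have "\<dots> \<le> h * ?\<mu> * (D * k\<^sup>2)" using r by (intro mult_right_mono) auto
      finally show "cond_mean p U \<le> g * ?\<mu>" by (simp add: g_def algebra_simps)
    qed
    also have "card H * p ^ k / (2 * (g * ?\<mu>)) = 1 / (2 * g)"
      unfolding mean_def[symmetric] using \<mu> g by simp
    also have "{A. r \<le> induced A} = {A. (1 + \<epsilon>) * ?\<mu> \<le> real (induced A)}"
      unfolding r_def by (auto simp: nat_le_iff ceiling_le_iff)
    finally have P: "(1 / (2 * g)) ^ r \<le> measure_pmf.prob (binomial_subset V p) {A. (1 + \<epsilon>) * ?\<mu> \<le> real (induced A)}" .
    have "exp (- (ln (2 * g) * h) * ?\<mu>) \<le> exp (- ln (2 * g) * r)"
      using mult_left_mono[OF r, of "ln (2 * g)"] g by (simp add: mult.assoc)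
    also have "\<dots> = (1 / (2 * g)) ^ r"
    proof -
      have "exp (- ln (2 * g) * r) = exp (- ln (2 * g)) ^ r" by (simp add: mult.commute flip: exp_of_nat_mult)
      then show ?thesis using g by (simp add: exp_minus inverse_eq_divide)
    qed
    finally show "exp (- (ln (2 * g) * h) * ?\<mu>) \<le> measure_pmf.prob (binomial_subset V p) {A. (1 + \<epsilon>) * ?\<mu> \<le> real (induced A)}"
      using P by simp
  qed
qed

section \<open>Arithmetic progressions\<close>

definition APs :: "nat \<Rightarrow> nat \<Rightarrow> nat set set" where
  "APs k n = {S. S \<subseteq> {1..n} \<and> card S = k \<and> is_AP k S}"

text \<open>A progression through \<open>x\<close> and \<open>y\<close> is determined by their
  positions \<open>i < j\<close> in it.\<close>

lemma card_APs_containing_two_le: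
  assumes "x < y"
  shows "card {S \<in> APs k n. x \<in> S \<and> y \<in> S} \<le> k\<^sup>2"
proof -
  \<comment> \<open>Pairs with \<open>j \<le> i\<close> yield meaningless sets, which is harmless
    because the image only has to cover.\<close>
  let ?f = "\<lambda>(i, j). let d = (y - x) div (j - i) in {x - i * d + l * d | l. l < k}"
  have "{S \<in> APs k n. x \<in> S \<and> y \<in> S} \<subseteq> ?f ` ({..<k} \<times> {..<k})"
  proof
    fix S assume S: "S \<in> {S \<in> APs k n. x \<in> S \<and> y \<in> S}"
    then obtain a d where ad: "d > 0" "S = {a + i * d | i. i < k}"
      unfolding APs_def is_AP_def by blast
    with S obtain i j where ij: "i < k" "x = a + i * d" "j < k" "y = a + j * d" by blast
    then have "i * d < j * d" using assms by simp
    then have "i < j" by simp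
    have "y - x = (j - i) * d" using ij by (simp add: diff_mult_distrib)
    then have "(y - x) div (j - i) = d" using \<open>i < j\<close> by simp
    moreover have "x - i * d = a" using ij by simp
    ultimately have "?f (i, j) = S" using ad by simp
    then show "S \<in> ?f ` ({..<k} \<times> {..<k})" using ij by (intro image_eqI[of _ _ "(i, j)"]) auto
  qed
  then have "card {S \<in> APs k n. x \<in> S \<and> y \<in> S} \<le> card ({..<k} \<times> {..<k})"
    by (rule surj_card_le[rotated]) simp
  then show ?thesis by (simp add: power2_eq_square)
qed

lemma codegree_hypergraph_APs:
  assumes "3 \<le> k"
  shows "codegree_hypergraph {1..n} (APs k n) k (k\<^sup>2)"
proof
  fix x y :: nat assume "x \<noteq> y"
  then consider "x < y" | "y < x" by linarith
  then show "card {S \<in> APs k n. x \<in> S \<and> y \<in> S} \<le> k\<^sup>2"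
  proof cases
    case 1
    then show ?thesis by (rule card_APs_containing_two_le)
  next
    case 2
    then show ?thesis using card_APs_containing_two_le[OF 2, of k n] by (simp add: conj_commute)
  qed
qed (use assms in \<open>auto simp: APs_def\<close>)

lemma real_div_ge:
  assumes "q \<le> m" "0 < q"
  shows "real m / (2 * real q) \<le> real (m div q)"
proof -
  have "1 \<le> m div q" using assms by (simp add: Suc_leI div_greater_zero_iff)
  moreover have "m < q * (m div q) + q" using dividend_less_times_div[OF assms(2), of m] by simp
  ultimately have "m \<le> 2 * q * (m div q)" 
    using mult_le_mono2[of 1 "m div q" q] by linarith
  then have "real m \<le> 2 * real q * real (m div q)" by (metis of_nat_le_iff of_nat_mult of_nat_numeral)
  then show ?thesis using assms(2) by (simp add: field_simps)
qed

text \<open>A start in the lower half and a difference up to \<open>m div (2 * k)\<close> keep the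
  progression inside \<open>{1..m}\<close>. Each floor loses at most a factor 2, which gives
  \<open>(1 / 4) * (1 / (4 * k))\<close>.\<close>

lemma card_APs_ge:
  assumes k: "2 \<le> k" and m: "2 * k \<le> m"
  shows "1 / (16 * real k) * (real m)\<^sup>2 \<le> card (APs k m)"
proof -
  let ?f = "\<lambda>(a, d). {a + i * d | i. i < k}"
  let ?X = "{1..m div 2} \<times> {1..m div (2 * k)}"
  have inj: "inj_on ?f ?X"
  proof (rule inj_onI, clarsimp)
    fix a d b e
    assume pos: "Suc 0 \<le> d" "Suc 0 \<le> e" and eq: "{a + i * d | i. i < k} = {b + i * e | i. i < k}"
    \<comment> \<open>Locating \<open>a\<close> and \<open>a + d\<close> in the other progression
      gives one inequality for the starts and, for equal starts, one for the differences; exchanging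
      the roles gives the reverse ones.\<close>
    have sub: "b \<le> a \<and> (a = b \<longrightarrow> e \<le> d)"
      if "{a + i * d | i. i < k} = {b + i * e | i. i < k}" "Suc 0 \<le> d" for a b d e
    proof -
      have "a \<in> {a + i * d | i. i < k}" "a + d \<in> {a + i * d | i. i < k}"
        using k by (intro CollectI exI[of _ 0] exI[of _ 1]; simp)+
      then have "a \<in> {b + i * e | i. i < k}" "a + d \<in> {b + i * e | i. i < k}"
        by (simp_all only: that(1))
      then obtain i j where "a = b + i * e" "a + d = b + j * e" by blast
      moreover from this have "j \<noteq> 0 \<or> a \<noteq> b" using that(2) by auto
      ultimately show ?thesis by (cases j) auto
    qed
    show "a = b \<and> d = e" using sub[OF eq pos(1)] sub[OF eq[symmetric] pos(2)] by auto
  qed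
  have sub: "?f ` ?X \<subseteq> APs k m"
  proof clarsimp
    fix a d assume a: "Suc 0 \<le> a" "a \<le> m div 2" and d: "Suc 0 \<le> d" "d \<le> m div (2 * k)"
    have "a + i * d \<le> m" if "i < k" for i
    proof -
      have "i * d \<le> k * (m div (2 * k))" using that d by (intro mult_mono) auto
      also have "\<dots> = k * (m div 2 div k)" by (simp add: div_mult2_eq)
      also have "\<dots> \<le> m div 2" by simp
      finally show ?thesis using a by linarith
    qed
    moreover have "{a + i * d | i. i < k} = (\<lambda>i. a + i * d) ` {..<k}" by auto
    moreover have "card ((\<lambda>i. a + i * d) ` {..<k}) = k"
      using d by (subst card_image) (auto simp: inj_on_def)
    moreover have "is_AP k {a + i * d | i. i < k}"
      unfolding is_AP_def using d by (intro exI[of _ a] exI[of _ d]) auto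
    ultimately show "{a + i * d | i. i < k} \<in> APs k m"
      using a unfolding APs_def by auto
  qed
  have fin: "finite (APs k m)" by (rule finite_subset[of _ "Pow {1..m}"]) (auto simp: APs_def)
  have "1 / (16 * real k) * (real m)\<^sup>2 = (real m / (2 * real 2)) * (real m / (2 * real (2 * k)))"
    by (simp add: power2_eq_square)
  also have "\<dots> \<le> real (m div 2) * real (m div (2 * k))"
    using real_div_ge[of 2 m] real_div_ge[of "2 * k" m] k m by (intro mult_mono) auto
  also have "\<dots> = card (?f ` ?X)" using inj by (subst card_image) auto
  also have "\<dots> \<le> card (APs k m)" using card_mono[OF fin sub] by simp
  finally show ?thesis .
qed

lemma dense_hypergraph_APs:
  assumes "3 \<le> k" "2 * k \<le> n"
  shows "dense_hypergraph {1..n} (APs k n) k (k\<^sup>2) (1 / (16 * real k))"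
proof -
  interpret codegree_hypergraph "{1..n}" "APs k n" k "k\<^sup>2" by (rule codegree_hypergraph_APs) fact
  show ?thesis
    by unfold_locales (use assms card_APs_ge[of k n] in auto)
qed

lemma AP_count_eq_induced:
  assumes "3 \<le> k" "A \<subseteq> {1..n}"
  shows "AP_count k A = codegree_hypergraph.induced (APs k n) A"
proof -
  interpret codegree_hypergraph "{1..n}" "APs k n" k "k\<^sup>2" by (rule codegree_hypergraph_APs) fact
  have "{S. S \<subseteq> A \<and> card S = k \<and> is_AP k S} = {S \<in> APs k n. S \<subseteq> A}"
    using assms(2) by (auto simp: APs_def)
  then show ?thesis by (simp add: AP_count_def induced_def)
qed

lemma random_subset_eq: "random_subset n p = binomial_subset {1..n} p"
  unfolding random_subset_def binomial_subset_def ..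

lemma AP_mean_eq:
  assumes "3 \<le> k" "0 \<le> p" "p \<le> 1"
  shows "AP_mean n k p = real (card (APs k n)) * p ^ k"
proof -
  interpret codegree_hypergraph "{1..n}" "APs k n" k "k\<^sup>2" by (rule codegree_hypergraph_APs) fact
  have "AP_mean n k p = measure_pmf.expectation (binomial_subset {1..n} p) (\<lambda>A. real (induced A))"
    unfolding AP_mean_def random_subset_eq
  proof (rule integral_cong_AE)
    \<comment> \<open>\<open>induced\<close> ignores progressions outside \<open>{1..n}\<close>, so
      the two counts are compared only on the support of the distribution.\<close>
    show "AE A in binomial_subset {1..n} p. real (AP_count k A) = real (induced A)"
      using set_binomial_subset[of "{1..n}" p] AP_count_eq_induced[OF assms(1)]
      by (auto simp: AE_measure_pmf_iff)
  qed auto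
  then show ?thesis using expectation_induced assms by simp
qed

lemma prob_AP_count_eq:
  assumes "3 \<le> k"
  shows "measure_pmf.prob (random_subset n p) {A. t \<le> real (AP_count k A)}
    = measure_pmf.prob (binomial_subset {1..n} p) {A. t \<le> real (codegree_hypergraph.induced (APs k n) A)}"
  unfolding random_subset_eq
proof (rule measure_pmf.finite_measure_eq_AE)
  show "AE A in binomial_subset {1..n} p. A \<in> {A. t \<le> real (AP_count k A)}
      \<longleftrightarrow> A \<in> {A. t \<le> real (codegree_hypergraph.induced (APs k n) A)}"
    using set_binomial_subset[of "{1..n}" p] AP_count_eq_induced[OF assms]
    by (auto simp: AE_measure_pmf_iff)
qed auto

lemma AP_count_mono: "A \<subseteq> B \<Longrightarrow> finite B \<Longrightarrow> AP_count k A \<le> AP_count k B"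
  unfolding AP_count_def by (rule card_mono) (auto intro: finite_subset[of _ "Pow B"])

text \<open>An initial interval of length of order \<open>sqrt t\<close> already contains
  \<open>t\<close> progressions, and it lies in the random set with probability
  \<open>p ^ m\<close>.\<close>

lemma prob_AP_count_ge_interval:
  fixes p t :: real
  assumes k: "2 \<le> k" and p: "0 < p" "p \<le> 1" and t: "1 \<le> t" "t \<le> AP_count k {1..n}"
  shows "exp (- ((2 * real k + 1 + sqrt (16 * real k)) * sqrt t) * ln (1 / p))
    \<le> measure_pmf.prob (random_subset n p) {A. t \<le> real (AP_count k A)}"
proof -
  \<comment> \<open>\<open>2 * k\<close> is the smallest length covered by
    \<open>card_APs_ge\<close>; the other term solves
    \<open>s\<^sup>2 / (16 * k) \<ge> t\<close>.\<close>
  define s where "s = max (2 * k) (nat \<lceil>sqrt (16 * k * t)\<rceil>)"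
  \<comment> \<open>If \<open>n \<le> s\<close>, all of \<open>{1..n}\<close> is planted, which
    suffices by the assumption \<open>t \<le> AP_count k {1..n}\<close>.\<close>
  define m where "m = min n s"
  have "1 \<le> sqrt t" using t by simp
  have "real s \<le> 2 * k + (sqrt (16 * k * t) + 1)"
    unfolding s_def using t by (simp add: max_def) linarith
  also have "\<dots> = (2 * k + 1) * 1 + sqrt (16 * k) * sqrt t" by (simp add: real_sqrt_mult)
  also have "\<dots> \<le> (2 * k + 1) * sqrt t + sqrt (16 * k) * sqrt t"
    using \<open>1 \<le> sqrt t\<close> by (intro add_right_mono mult_left_mono) auto
  finally have m: "real m \<le> (2 * real k + 1 + sqrt (16 * real k)) * sqrt t"
    unfolding m_def by (simp add: algebra_simps)
  have tm: "t \<le> AP_count k {1..m}"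
  proof (cases "n \<le> s")
    case True
    then show ?thesis using t unfolding m_def by simp
  next
    case False
    have "t = 1 / (16 * real k) * (sqrt (16 * k * t))\<^sup>2" using k t by simp
    also have "\<dots> \<le> 1 / (16 * real k) * (real s)\<^sup>2"
    proof (intro mult_left_mono power_mono)
      show "sqrt (16 * k * t) \<le> real s"
        by (rule order.trans[OF real_nat_ceiling_ge]) (simp add: s_def)
    qed (use t in auto)
    also have "\<dots> \<le> card (APs k s)" by (rule card_APs_ge[OF k]) (simp add: s_def)
    finally show ?thesis using False by (simp add: m_def AP_count_def APs_def)
  qed
  have L: "0 \<le> ln (1 / p)" using p by simp
  have "exp (- ((2 * real k + 1 + sqrt (16 * real k)) * sqrt t) * ln (1 / p)) \<le> exp (- real m * ln (1 / p))"
    using mult_right_mono[OF m L] by simp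
  also have "\<dots> = p ^ m"
    using p by (simp add: ln_div exp_of_nat_mult)
  also have "\<dots> = measure_pmf.prob (random_subset n p) {A. {1..m} \<subseteq> A}"
    unfolding random_subset_eq using prob_superset[of "{1..n}" "{1..m}" p] p by (simp add: m_def)
  also have "\<dots> = measure_pmf.prob (random_subset n p) ({A. {1..m} \<subseteq> A} \<inter> set_pmf (random_subset n p))"
    by (rule measure_Int_set_pmf[symmetric])
  also have "\<dots> \<le> measure_pmf.prob (random_subset n p) {A. t \<le> real (AP_count k A)}"
  proof (rule measure_pmf.finite_measure_mono)
    show "{A. {1..m} \<subseteq> A} \<inter> set_pmf (random_subset n p) \<subseteq> {A. t \<le> real (AP_count k A)}"
    proof
      fix A assume A: "A \<in> {A. {1..m} \<subseteq> A} \<inter> set_pmf (random_subset n p)"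
      then have "A \<subseteq> {1..n}" using set_binomial_subset[of "{1..n}" p] unfolding random_subset_eq by blast
      then have "finite A" by (rule finite_subset) simp
      then have "AP_count k {1..m} \<le> AP_count k A" using A by (intro AP_count_mono) auto
      then show "A \<in> {A. t \<le> real (AP_count k A)}" using tm by simp
    qed
  qed auto
  finally show ?thesis .
qed

section \<open>Both tail bounds for arithmetic progressions\<close>

theorem mainTheorem3:
  fixes k :: nat and \<epsilon> :: real
  assumes "k \<ge> 3" and "\<epsilon> > 0"
  shows "\<exists>c C :: real. \<exists>n\<^sub>0 :: nat. c > 0 \<and> C > 0 \<and>
    (\<forall>n \<ge> n\<^sub>0. \<forall>p :: real. 0 < p \<longrightarrow> p \<le> 1 \<longrightarrow>
      1 \<le> (1 + \<epsilon>) * AP_mean n k p \<longrightarrow>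
      (1 + \<epsilon>) * AP_mean n k p \<le> real (AP_count k {1..n}) \<longrightarrow>
      (let \<mu> = AP_mean n k p;
           \<Phi> = min \<mu> (sqrt \<mu> * ln (1 / p));
           P = measure_pmf.prob (random_subset n p) {A. real (AP_count k A) \<ge> (1 + \<epsilon>) * \<mu>}
       in exp (- C * \<Phi>) \<le> P \<and> P \<le> exp (- c * \<Phi>)))"
proof -
  define \<gamma> where "\<gamma> = 1 / (16 * real k)"
  have \<gamma>: "0 < \<gamma>" and D: "0 < k\<^sup>2" using assms(1) by (auto simp: \<gamma>_def)
  obtain c where c: "0 < c" "\<And>V H p. dense_hypergraph (V :: nat set) H k (k\<^sup>2) \<gamma> \<Longrightarrow> 0 < p \<Longrightarrow> p \<le> 1 \<Longrightarrow>
    measure_pmf.prob (binomial_subset V p)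
      {A. (1 + \<epsilon>) * dense_hypergraph.mean H k p \<le> real (codegree_hypergraph.induced H A)}
    \<le> exp (- c * dense_hypergraph.rate H k p)"
    using upper_tail_constant_exists[OF assms(2) \<gamma> D assms(1)] by blast
  obtain C1 :: real and n1 :: nat where C1: "0 < C1"
    "\<And>V H p. dense_hypergraph (V :: nat set) H k (k\<^sup>2) \<gamma> \<Longrightarrow> n1 \<le> card V \<Longrightarrow> 0 < p \<Longrightarrow> p \<le> 1 \<Longrightarrow>
    1 \<le> (1 + \<epsilon>) * dense_hypergraph.mean H k p \<Longrightarrow>
    sqrt (dense_hypergraph.mean H k p) \<le> ln (1 / p) \<Longrightarrow>
    exp (- C1 * dense_hypergraph.mean H k p) \<le> measure_pmf.prob (binomial_subset V p)
      {A. (1 + \<epsilon>) * dense_hypergraph.mean H k p \<le> real (codegree_hypergraph.induced H A)}"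
    using lower_tail_small_mean_constant_exists[OF assms(2) \<gamma> D assms(1)] by blast
  \<comment> \<open>The interval is planted for \<open>t = (1 + \<epsilon>) * \<mu>\<close>, whose
    square root splits off the factor \<open>sqrt (1 + \<epsilon>)\<close>.\<close>
  define C2 where "C2 = (2 * real k + 1 + sqrt (16 * real k)) * sqrt (1 + \<epsilon>)"
  have C2: "0 \<le> C2" using assms(2) by (simp add: C2_def)
  define C where "C = C1 + C2"
  have bounds: "exp (- C * min \<mu> (sqrt \<mu> * ln (1 / p))) \<le> P \<and> P \<le> exp (- c * min \<mu> (sqrt \<mu> * ln (1 / p)))"
    if n: "max n1 (2 * k) \<le> n" and p: "0 < p" "p \<le> 1"
      and \<mu>: "\<mu> = AP_mean n k p" and \<mu>_ge: "1 \<le> (1 + \<epsilon>) * \<mu>"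
      and \<mu>_le: "(1 + \<epsilon>) * \<mu> \<le> real (AP_count k {1..n})"
      and P: "P = measure_pmf.prob (random_subset n p) {A. (1 + \<epsilon>) * \<mu> \<le> real (AP_count k A)}"
    for n p \<mu> P
  proof -
    have hyp: "dense_hypergraph {1..n} (APs k n) k (k\<^sup>2) \<gamma>"
      unfolding \<gamma>_def using dense_hypergraph_APs[of k n] assms(1) n by simp
    then interpret dense_hypergraph "{1..n}" "APs k n" k "k\<^sup>2" \<gamma> .
    have mean: "mean p = \<mu>" using AP_mean_eq[OF assms(1)] p by (simp add: \<mu> mean_def)
    have P': "P = measure_pmf.prob (binomial_subset {1..n} p) {A. (1 + \<epsilon>) * mean p \<le> real (induced A)}"
      unfolding P mean by (rule prob_AP_count_eq) (rule assms(1))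
    have \<mu>0: "0 < \<mu>" using mean_pos[OF p(1)] mean by simp
    have L: "0 \<le> ln (1 / p)" using p by simp
    have upper: "P \<le> exp (- c * min \<mu> (sqrt \<mu> * ln (1 / p)))"
      using c(2)[OF hyp p] unfolding P' rate_def mean .
    have lower: "exp (- C * min \<mu> (sqrt \<mu> * ln (1 / p))) \<le> P"
    \<comment> \<open>The case distinction decides which term attains the minimum: packings give the
      bound for \<open>\<mu>\<close>, a planted interval the one for
      \<open>sqrt \<mu> * ln (1 / p)\<close>.\<close>
    proof (cases "sqrt \<mu> \<le> ln (1 / p)")
      case True
      have "sqrt \<mu> * sqrt \<mu> \<le> sqrt \<mu> * ln (1 / p)" using True \<mu>0 by (intro mult_left_mono) auto
      then have "min \<mu> (sqrt \<mu> * ln (1 / p)) = \<mu>" using \<mu>0 by simp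
      moreover have "exp (- C1 * \<mu>) \<le> P"
        using C1(2)[OF hyp _ p] n \<mu>_ge True unfolding P' mean by simp
      moreover have "exp (- C * \<mu>) \<le> exp (- C1 * \<mu>)" using C2 \<mu>0 by (simp add: C_def algebra_simps)
      ultimately show ?thesis by (metis order_trans)
    next
      case False
      have "sqrt \<mu> * ln (1 / p) \<le> sqrt \<mu> * sqrt \<mu>" using False \<mu>0 by (intro mult_left_mono) auto
      then have "min \<mu> (sqrt \<mu> * ln (1 / p)) = sqrt \<mu> * ln (1 / p)" using \<mu>0 by simp
      moreover have "exp (- (C2 * sqrt \<mu>) * ln (1 / p)) \<le> P"
        using prob_AP_count_ge_interval[OF _ p \<mu>_ge \<mu>_le] assms(1)
        unfolding P C2_def by (simp add: real_sqrt_mult mult.assoc)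
      moreover have "exp (- C * (sqrt \<mu> * ln (1 / p))) \<le> exp (- (C2 * sqrt \<mu>) * ln (1 / p))"
      proof -
        have "C2 * (sqrt \<mu> * ln (1 / p)) \<le> C * (sqrt \<mu> * ln (1 / p))"
          using C1(1) \<mu>0 L by (intro mult_right_mono) (auto simp: C_def)
        then show ?thesis by (simp add: mult.assoc)
      qed
      ultimately show ?thesis by (metis order_trans)
    qed
    from upper lower show ?thesis by simp
  qed
  show ?thesis
  \<comment> \<open>\<open>2 * k\<close> ensures the density of the progressions, \<open>n1\<close>
    the room for packings.\<close>
  proof (rule exI[of _ c], rule exI[of _ C], rule exI[of _ "max n1 (2 * k)"], intro conjI allI impI)
    show "0 < c" by (rule c(1))
    show "0 < C" using C1(1) C2 by (simp add: C_def)
    fix n p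
    assume "max n1 (2 * k) \<le> n" "0 < p" "p \<le> 1" "1 \<le> (1 + \<epsilon>) * AP_mean n k p"
      "(1 + \<epsilon>) * AP_mean n k p \<le> real (AP_count k {1..n})"
    from bounds[OF this(1-3) refl this(4,5) refl]
    show "let \<mu> = AP_mean n k p;
           \<Phi> = min \<mu> (sqrt \<mu> * ln (1 / p));
           P = measure_pmf.prob (random_subset n p) {A. real (AP_count k A) \<ge> (1 + \<epsilon>) * \<mu>}
       in exp (- C * \<Phi>) \<le> P \<and> P \<le> exp (- c * \<Phi>)"
      unfolding Let_def .
  qed
qed

end
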